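(* Let $n\ge 1$, let $r,s\in\mathbb C$ be generic, and let $A=(a_{ij})_{1\le i,j\le 2n}$ be the generator matrix of the quantum semigroup $\mathcal A_{r,s}(2n)$. For $1\le i<j\le 2n$ let $$b_{ij}=\sum_{m=1}^n\mathrm{cdet}_{s^{-1}}\big(A^{2m-1,2m}_{i,j}\big),\qquad b'_{ij}=\sum_{m=1}^n\mathrm{rdet}_{r}\big(A^{i,j}_{2m-1,2m}\big),$$ and let $B=(b_{ij})$, $B'=(b'_{ij})$. Then $$\mathrm{Pf}_r(B)=\mathrm{Pf}_{s^{-1}}(B').$$
   Context: Generic means: $r,s$ are nonzero and none of $r$, $s$, $r/s$ is a root of unity. For $N\ge1$, $\mathcal A_{r,s}(N)$ is the unital associative $\mathbb C$-algebra generated by $a_{ij}$, $1\le i,j\le N$, subject to the relations, for all $i<j$ and $k<l$ (the first for every row $i$, the second for every column $k$): $a_{ik}a_{il}=r\,a_{il}a_{ik}$; $a_{ik}a_{jk}=s^{-1}a_{jk}a_{ik}$; $r\,a_{il}a_{jk}=s^{-1}a_{jk}a_{il}$; $a_{ik}a_{jl}-a_{jl}a_{ik}=(r-s)a_{il}a_{jk}$. Minors with rows $i_1,\dots,i_t$ (superscripts) and columns $j_1,\dots,j_t$ (subscripts): $\mathrm{rdet}_r(A^{i_1\ldots i_t}_{j_1\ldots j_t})=\sum_{\sigma\in S_t}(-r)^{l(\sigma)}a_{i_1,j_{\sigma(1)}}\cdots a_{i_t,j_{\sigma(t)}}$ and $\mathrm{cdet}_{s^{-1}}(A^{i_1\ldots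 i_t}_{j_1\ldots j_t})=\sum_{\sigma\in S_t}(-s)^{-l(\sigma)}a_{i_{\sigma(1)},j_1}\cdots a_{i_{\sigma(t)},j_t}$, where $l(\sigma)$ is the number of inversions. Thus $\mathrm{cdet}_{s^{-1}}(A^{2m-1,2m}_{i,j})=a_{2m-1,i}a_{2m,j}-s^{-1}a_{2m,i}a_{2m-1,j}$ and $\mathrm{rdet}_r(A^{i,j}_{2m-1,2m})=a_{i,2m-1}a_{j,2m}-r\,a_{i,2m}a_{j,2m-1}$. For a $2n\times 2n$ array $B=(b_{ij})$ with entries in an associative $\mathbb C$-algebra, the quantum Pfaffian (which only involves the entries with $i<j$) is $$\mathrm{Pf}_v(B)=\frac1{[n]_{v^4}!}\sum_{\sigma\in\Pi'}(-v)^{l(\sigma)}b_{\sigma(1)\sigma(2)}b_{\sigma(3)\sigma(4)}\cdots b_{\sigma(2n-1)\sigma(2n)},$$ where $\Pi'$ is the set of $\sigma\in S_{2n}$ with $\sigma(2i-1)<\sigma(2i)$ for $i=1,\dots,n$, and $[n]_u!=[n]_u\cdots[1]_u$, $[k]_u=1+u+\cdots+u^{k-1}$. *)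

theory Defs
  imports Complex_Main "HOL-Library.Poly_Mapping" "HOL-Combinatorics.Permutations"
    "HOL-Algebra.QuotRing" "HOL-Algebra.Module"
begin

definition root_of_unity :: "complex \<Rightarrow> bool" where
  "root_of_unity z \<longleftrightarrow> (\<exists>k>0. z ^ k = 1)"

definition generic :: "complex \<Rightarrow> complex \<Rightarrow> bool" where
  "generic r s \<longleftrightarrow> r \<noteq> 0 \<and> s \<noteq> 0 \<and>
     \<not> root_of_unity r \<and> \<not> root_of_unity s \<and> \<not> root_of_unity (r / s)"

subsection \<open>Free algebras\<close>

text \<open>
  The free monoid on \<open>'a\<close>, written additively so that the convolution product on
  \<open>'a fmon \<Rightarrow>\<^sub>0 complex\<close> provided by \<open>HOL-Library.Poly_Mapping\<close> is the
  product of the free associative algebra.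
\<close>

datatype 'a fmon = Fmon (letters: "'a list")

instantiation fmon :: (type) monoid_add
begin

definition zero_fmon :: "'a fmon" where
  "zero_fmon = Fmon []"

definition plus_fmon :: "'a fmon \<Rightarrow> 'a fmon \<Rightarrow> 'a fmon" where
  "plus_fmon u v = Fmon (letters u @ letters v)"

instance
  by standard (simp_all add: zero_fmon_def plus_fmon_def)

end

type_synonym 'a falg = "'a fmon \<Rightarrow>\<^sub>0 complex"

definition fscal :: "complex \<Rightarrow> 'a falg" where
  "fscal c = Poly_Mapping.single 0 c"

definition fgen :: "'a \<Rightarrow> 'a falg" where
  "fgen x = Poly_Mapping.single (Fmon [x]) 1"

definition free_algebra :: "'a set \<Rightarrow> 'a falg ring" where
  "free_algebra X =
     \<lparr>carrier = {f. \<forall>w\<in>Poly_Mapping.keys f. set (letters w) \<subseteq> X},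
      mult = (*), one = 1, zero = 0, add = (+)\<rparr>"

subsection \<open>The quantum semigroup\<close>

definition qsemigroup_rels :: "complex \<Rightarrow> complex \<Rightarrow> nat \<Rightarrow> (nat \<times> nat) falg set" where
  "qsemigroup_rels r s N = (let a = (\<lambda>i j. fgen (i, j)) in
     {a i k * a i l - fscal r * a i l * a i k | i k l.
        i \<in> {1..N} \<and> k \<in> {1..N} \<and> l \<in> {1..N} \<and> k < l} \<union>
     {a i k * a j k - fscal (inverse s) * a j k * a i k | i j k.
        i \<in> {1..N} \<and> j \<in> {1..N} \<and> k \<in> {1..N} \<and> i < j} \<union>
     {fscal r * a i l * a j k - fscal (inverse s) * a j k * a i l | i j k l.
        i \<in> {1..N} \<and> j \<in> {1..N} \<and> k \<in> {1..N} \<and> l \<in> {1..N} \<and> i < j \<and> k < l} \<union>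
     {a i k * a j l - a j l * a i k - fscal (r - s) * a i l * a j k | i j k l.
        i \<in> {1..N} \<and> j \<in> {1..N} \<and> k \<in> {1..N} \<and> l \<in> {1..N} \<and> i < j \<and> k < l})"

definition qsemigroup_ideal :: "complex \<Rightarrow> complex \<Rightarrow> nat \<Rightarrow> (nat \<times> nat) falg set" where
  "qsemigroup_ideal r s N =
     genideal (free_algebra ({1..N} \<times> {1..N})) (qsemigroup_rels r s N)"

definition qclass :: "complex \<Rightarrow> complex \<Rightarrow> nat \<Rightarrow> (nat \<times> nat) falg \<Rightarrow> (nat \<times> nat) falg set" where
  "qclass r s N f =
     qsemigroup_ideal r s N +>\<^bsub>free_algebra ({1..N} \<times> {1..N})\<^esub> f"

text \<open>
  The quotient ring, made a \<open>\<complex>\<close>-algebra through the record field \<open>smult\<close>: the scalar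
  \<open>c\<close> acts as multiplication by the class of \<open>c \<cdot> 1\<close>.
\<close>

definition qsemigroup ::
  "complex \<Rightarrow> complex \<Rightarrow> nat \<Rightarrow> (complex, (nat \<times> nat) falg set) module" where
  "qsemigroup r s N =
     (let Q = free_algebra ({1..N} \<times> {1..N}) Quot qsemigroup_ideal r s N in
      ring.extend Q (module.fields (\<lambda>c x. qclass r s N (fscal c) \<otimes>\<^bsub>Q\<^esub> x)))"

definition qgen :: "complex \<Rightarrow> complex \<Rightarrow> nat \<Rightarrow> nat \<Rightarrow> nat \<Rightarrow> (nat \<times> nat) falg set" where
  "qgen r s N i j = qclass r s N (fgen (i, j))"

lemma free_algebra_ring: "ring (free_algebra X)"
proof (rule ringI)
  have add: "f + g \<in> carrier (free_algebra X)"
    if "f \<in> carrier (free_algebra X)" "g \<in> carrier (free_algebra X)" for f g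
    using that Poly_Mapping.keys_add[of f g] by (force simp: free_algebra_def)
  have mult: "f * g \<in> carrier (free_algebra X)"
    if "f \<in> carrier (free_algebra X)" "g \<in> carrier (free_algebra X)" for f g
    using that keys_mult[of f g] by (force simp: free_algebra_def plus_fmon_def)
  have uminus: "- f \<in> carrier (free_algebra X)" if "f \<in> carrier (free_algebra X)" for f
    using that by (simp add: free_algebra_def)
  show "abelian_group (free_algebra X)"
  proof (rule abelian_groupI)
    fix f assume "f \<in> carrier (free_algebra X)"
    then show "\<exists>g\<in>carrier (free_algebra X). g \<oplus>\<^bsub>free_algebra X\<^esub> f = \<zero>\<^bsub>free_algebra X\<^esub>"
      using uminus[of f] by (intro bexI[of _ "- f"]) (simp_all add: free_algebra_def)
  next
    fix f g assume "f \<in> carrier (free_algebra X)" "g \<in> carrier (free_algebra X)"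
    from add[OF this] show "f \<oplus>\<^bsub>free_algebra X\<^esub> g \<in> carrier (free_algebra X)"
      by (simp add: free_algebra_def)
  qed (simp_all add: free_algebra_def algebra_simps)
  show "Group.monoid (free_algebra X)"
  proof (rule Group.monoidI)
    show "\<one>\<^bsub>free_algebra X\<^esub> \<in> carrier (free_algebra X)"
      by (simp add: free_algebra_def zero_fmon_def)
  next
    fix f g assume "f \<in> carrier (free_algebra X)" "g \<in> carrier (free_algebra X)"
    from mult[OF this] show "f \<otimes>\<^bsub>free_algebra X\<^esub> g \<in> carrier (free_algebra X)"
      by (simp add: free_algebra_def)
  qed (simp_all add: free_algebra_def algebra_simps)
qed (simp_all add: free_algebra_def algebra_simps)

lemma fscal_carrier: "fscal c \<in> carrier (free_algebra X)"
  by (simp add: free_algebra_def fscal_def zero_fmon_def)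

lemma fgen_carrier: "x \<in> X \<Longrightarrow> fgen x \<in> carrier (free_algebra X)"
  by (simp add: free_algebra_def fgen_def)

lemma qsemigroup_rels_carrier: "qsemigroup_rels r s N \<subseteq> carrier (free_algebra ({1..N} \<times> {1..N}))"
proof -
  let ?F = "free_algebra ({1..N} \<times> {1..N})"
  interpret ring ?F by (rule free_algebra_ring)
  have m: "f * g \<in> carrier ?F" if "f \<in> carrier ?F" "g \<in> carrier ?F" for f g
    using m_closed[OF that] by (simp add: free_algebra_def)
  have d: "f - g \<in> carrier ?F" if "f \<in> carrier ?F" "g \<in> carrier ?F" for f g
    using that Poly_Mapping.keys_diff[of f g] by (force simp: free_algebra_def)
  have g: "fgen (i, j) \<in> carrier ?F" if "i \<in> {1..N}" "j \<in> {1..N}" for i j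
    using that by (intro fgen_carrier) blast
  show ?thesis
    unfolding qsemigroup_rels_def Let_def
    by (intro Un_least subsetI; elim CollectE exE conjE; hypsubst)
      (intro m d g fscal_carrier; assumption)+
qed

lemma qsemigroup_ideal: "ideal (qsemigroup_ideal r s N) (free_algebra ({1..N} \<times> {1..N}))"
  unfolding qsemigroup_ideal_def
  by (rule ring.genideal_ideal[OF free_algebra_ring qsemigroup_rels_carrier])

lemma qsemigroup_simps:
  fixes r s N
  defines "Q \<equiv> free_algebra ({1..N} \<times> {1..N}) Quot qsemigroup_ideal r s N"
  shows "carrier (qsemigroup r s N) = carrier Q"
    and "x \<otimes>\<^bsub>qsemigroup r s N\<^esub> y = x \<otimes>\<^bsub>Q\<^esub> y"
    and "\<one>\<^bsub>qsemigroup r s N\<^esub> = \<one>\<^bsub>Q\<^esub>"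
    and "x \<oplus>\<^bsub>qsemigroup r s N\<^esub> y = x \<oplus>\<^bsub>Q\<^esub> y"
    and "\<zero>\<^bsub>qsemigroup r s N\<^esub> = \<zero>\<^bsub>Q\<^esub>"
    and "c \<odot>\<^bsub>qsemigroup r s N\<^esub> x = qclass r s N (fscal c) \<otimes>\<^bsub>Q\<^esub> x"
  unfolding qsemigroup_def Q_def Let_def ring.defs module.defs by simp_all

lemma qsemigroup_ring: "ring (qsemigroup r s N)"
proof -
  define Q where "Q = free_algebra ({1..N} \<times> {1..N}) Quot qsemigroup_ideal r s N"
  interpret Q: ring Q
    unfolding Q_def by (rule ideal.quotient_is_ring[OF qsemigroup_ideal])
  note simps = qsemigroup_simps[of r s N, folded Q_def]
  show ?thesis
  proof (rule ringI)
    show "abelian_group (qsemigroup r s N)"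
    proof (rule abelian_groupI, unfold simps)
      fix x assume "x \<in> carrier Q"
      then show "\<exists>y\<in>carrier Q. y \<oplus>\<^bsub>Q\<^esub> x = \<zero>\<^bsub>Q\<^esub>"
        using Q.l_neg by blast
    qed (rule Q.a_closed Q.zero_closed Q.a_assoc Q.a_comm Q.l_zero; assumption?)+
    show "Group.monoid (qsemigroup r s N)"
      by (rule Group.monoidI; unfold simps)
        (rule Q.m_closed Q.one_closed Q.m_assoc Q.l_one Q.r_one; assumption?)+
  qed (unfold simps, (rule Q.l_distr Q.r_distr; assumption)+)
qed

subsection \<open>Quantum minors and Pfaffians\<close>

text \<open>
  Below, a complex algebra is given by a record \<open>R\<close> whose product need not be commutative;
  products of several factors are ordered as in the list.
\<close>

definition inv_count :: "nat set \<Rightarrow> (nat \<Rightarrow> nat) \<Rightarrow> nat" where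
  "inv_count T \<sigma> = card {(i, j). i \<in> T \<and> j \<in> T \<and> i < j \<and> \<sigma> i > \<sigma> j}"

definition lprod :: "('a, 'b) monoid_scheme \<Rightarrow> 'a list \<Rightarrow> 'a" where
  "lprod R xs = foldr (\<otimes>\<^bsub>R\<^esub>) xs \<one>\<^bsub>R\<^esub>"

text \<open>
  In both determinants \<open>is\<close> is the list of row indices and \<open>js\<close> the list of column indices,
  of the same length \<open>t\<close>; permutations act on the list positions \<open>0, \<dots>, t - 1\<close>.
  For \<open>q = s\<^sup>-\<^sup>1\<close> the coefficient \<open>(-q) ^ l\<close> is \<open>(-s)\<close> to the power \<open>-l\<close>.
\<close>

definition rdet :: "(complex, 'b) module \<Rightarrow> complex \<Rightarrow> (nat \<Rightarrow> nat \<Rightarrow> 'b) \<Rightarrow>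
    nat list \<Rightarrow> nat list \<Rightarrow> 'b" where
  "rdet R q a is js = (let t = length is in
     (\<Oplus>\<^bsub>R\<^esub>\<sigma>\<in>{\<sigma>. \<sigma> permutes {..<t}}.
        ((- q) ^ inv_count {..<t} \<sigma>) \<odot>\<^bsub>R\<^esub>
          lprod R (map (\<lambda>p. a (is ! p) (js ! \<sigma> p)) [0..<t])))"

definition cdet :: "(complex, 'b) module \<Rightarrow> complex \<Rightarrow> (nat \<Rightarrow> nat \<Rightarrow> 'b) \<Rightarrow>
    nat list \<Rightarrow> nat list \<Rightarrow> 'b" where
  "cdet R q a is js = (let t = length is in
     (\<Oplus>\<^bsub>R\<^esub>\<sigma>\<in>{\<sigma>. \<sigma> permutes {..<t}}.
        ((- q) ^ inv_count {..<t} \<sigma>) \<odot>\<^bsub>R\<^esub>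
          lprod R (map (\<lambda>p. a (is ! \<sigma> p) (js ! p)) [0..<t])))"

definition qint :: "complex \<Rightarrow> nat \<Rightarrow> complex" where
  "qint u k = (\<Sum>i<k. u ^ i)"

definition qfact :: "complex \<Rightarrow> nat \<Rightarrow> complex" where
  "qfact u n = (\<Prod>k=1..n. qint u k)"

definition pf_perms :: "nat \<Rightarrow> (nat \<Rightarrow> nat) set" where
  "pf_perms n = {\<sigma>. \<sigma> permutes {1..2*n} \<and> (\<forall>i\<in>{1..n}. \<sigma> (2*i - 1) < \<sigma> (2*i))}"

definition qpf :: "(complex, 'b) module \<Rightarrow> complex \<Rightarrow> nat \<Rightarrow> (nat \<Rightarrow> nat \<Rightarrow> 'b) \<Rightarrow> 'b" where
  "qpf R v n b = (1 / qfact (v ^ 4) n) \<odot>\<^bsub>R\<^esub>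
     (\<Oplus>\<^bsub>R\<^esub>\<sigma>\<in>pf_perms n.
        ((- v) ^ inv_count {1..2*n} \<sigma>) \<odot>\<^bsub>R\<^esub>
          lprod R (map (\<lambda>k. b (\<sigma> (2*k - 1)) (\<sigma> (2*k))) [1..<n+1]))"

end

theory Submission
  imports Defs
begin

text \<open>
  Let the \<open>x\<^sub>j\<close> satisfy \<open>x\<^sub>j\<^sup>2 = 0\<close> and \<open>x\<^sub>j x\<^sub>i = - r x\<^sub>i x\<^sub>j\<close> for \<open>i < j\<close>, and commute with the matrix
  entries. The relations of the quantum semigroup imply that the forms
  \<open>y\<^sub>i = a\<^sub>i\<^sub>1 x\<^sub>1 + a\<^sub>i\<^sub>2 x\<^sub>2 + \<cdots>\<close> satisfy the same relations. Put \<open>\<omega>\<^sub>m = y\<^sub>i y\<^sub>j\<close> with \<open>i = 2m - 1\<close>, \<open>j = 2m\<close>,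
  and let \<open>\<Omega>\<close> be the sum of the \<open>\<omega>\<^sub>m\<close>, which is also the sum of the \<open>b\<^sub>i\<^sub>j x\<^sub>i x\<^sub>j\<close> over \<open>i < j\<close>.
  The \<open>\<omega>\<^sub>m\<close> square to zero and commute up to \<open>r\<^sup>4\<close>, so computing the \<open>n\<close>-th power of \<open>\<Omega>\<close> in both
  ways and dividing by the quantum factorial identifies the Pfaffian of \<open>B\<close> with the row
  determinant of \<open>A\<close>. The transpose of \<open>A\<close> satisfies the relations for \<open>(s\<^sup>-\<^sup>1, r\<^sup>-\<^sup>1)\<close>, so the
  Pfaffian of \<open>B'\<close> is the column determinant of \<open>A\<close>, and the two determinants agree
  because \<open>r / s\<close> is not a root of unity.
\<close>

subsection \<open>Words and inversions\<close>

definition words :: "nat \<Rightarrow> 'b set \<Rightarrow> 'b list set" where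
  "words n S = {xs. length xs = n \<and> set xs \<subseteq> S}"

lemma finite_words: "finite S \<Longrightarrow> finite (words n S)"
  using finite_lists_length_eq[of S n] by (simp add: words_def conj_commute)

lemma words_0: "words 0 S = {[]}"
  by (auto simp: words_def)

lemma words_Suc: "words (Suc n) S = (\<lambda>(x, xs). x # xs) ` (S \<times> words n S)"
  by (auto simp: words_def length_Suc_conv image_iff)

lemma sum_words_Suc:
  assumes "finite S"
  shows "sum f (words (Suc n) S) = (\<Sum>x\<in>S. \<Sum>xs\<in>words n S. f (x # xs))"
proof -
  have "inj_on (\<lambda>(x, xs). x # xs) (S \<times> words n S)"
    by (auto simp: inj_on_def)
  then show ?thesis
    by (simp add: words_Suc sum.reindex sum.cartesian_product case_prod_unfold)
qed

lemma sum_words_add: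
  assumes "finite S"
  shows "sum f (words (m + n) S) = (\<Sum>xs\<in>words m S. \<Sum>ys\<in>words n S. f (xs @ ys))"
  by (induction m arbitrary: f) (simp_all add: words_0 sum_words_Suc assms)

lemma sum_Times: "sum g (A \<times> B) = (\<Sum>x\<in>A. \<Sum>y\<in>B. g (x, y))"
  by (simp add: sum.cartesian_product)

fun pair_list :: "'b \<times> 'b \<Rightarrow> 'b list" where
  "pair_list (x, y) = [x, y]"

lemma sum_words_pairs:
  assumes "finite S"
  shows "sum f (words (2 * n) S) = (\<Sum>ps\<in>words n (S \<times> S). f (concat (map pair_list ps)))"
proof (induction n arbitrary: f)
  case 0
  then show ?case by (simp add: words_0)
next
  case (Suc n)
  have "sum f (words (2 * Suc n) S) =
      (\<Sum>x\<in>S. \<Sum>y\<in>S. \<Sum>xs\<in>words (2 * n) S. f (x # y # xs))"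
    by (simp add: sum_words_Suc assms)
  also have "\<dots> = (\<Sum>x\<in>S. \<Sum>y\<in>S. \<Sum>ps\<in>words n (S \<times> S). f (x # y # concat (map pair_list ps)))"
    by (simp add: Suc.IH)
  finally show ?case
    by (simp add: sum_words_Suc assms sum_Times)
qed

lemma sum_words_prod_list:
  fixes g :: "'b \<Rightarrow> 'c \<Rightarrow> 'a::semiring_1"
  assumes "finite S"
  shows "(\<Sum>ms\<in>words (length ps) S. prod_list (map2 g ms ps)) =
    prod_list (map (\<lambda>p. \<Sum>m\<in>S. g m p) ps)"
proof (induction ps)
  case Nil
  then show ?case by (simp add: words_0)
next
  case (Cons p ps)
  then show ?case by (simp add: sum_words_Suc assms sum_product flip: Cons.IH)
qed

text \<open>
  The coefficient of the ordered monomial in the word \<open>w\<close> of a quantum exterior algebra,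
  where \<open>x\<^sub>j x\<^sub>i = t x\<^sub>i x\<^sub>j\<close> for \<open>i < j\<close> and \<open>x\<^sub>i x\<^sub>i = 0\<close>.
\<close>

primrec eps :: "complex \<Rightarrow> nat list \<Rightarrow> complex" where
  "eps t [] = 1"
| "eps t (x # xs) = (if x \<in> set xs then 0 else t ^ length (filter (\<lambda>y. y < x) xs) * eps t xs)"

text \<open>Every other letter still sees the same letters to its right, so only the pair of
  \<open>l\<close> and \<open>k\<close> gains an inversion. If a letter repeats, both sides
  vanish.\<close>

lemma eps_swap: "k < l \<Longrightarrow> eps t (u @ l # k # v) = t * eps t (u @ k # l # v)"
  by (induction u) auto

lemma eps_dup: "eps t (u @ k # k # v) = 0"
  by (induction u) auto

lemma eps_not_distinct: "\<not> distinct w \<Longrightarrow> eps t w = 0"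
  by (induction w) auto

text \<open>The exponent of \<open>t\<close> and the vanishing condition depend on \<open>w\<close>
  alone. This is what merges a row sign and a column sign into one sign with parameter
  \<open>r / s\<close>.\<close>

lemma eps_mult: "eps t w * eps t' w = eps (t * t') w"
  by (induction w) (auto simp: power_mult_distrib)

lemma eps_map:
  assumes "inj_on \<sigma> {a..<b}"
  shows "eps t (map \<sigma> [a..<b]) = t ^ inv_count {a..<b} \<sigma>"
  using assms
proof (induction "b - a" arbitrary: a)
  case 0
  then show ?case by (simp add: inv_count_def)
next
  case (Suc d)
  then have ab: "a < b" by simp
  let ?J = "{j \<in> {Suc a..<b}. \<sigma> j < \<sigma> a}"
  let ?P = "\<lambda>a. {(i, j). i \<in> {a..<b} \<and> j \<in> {a..<b} \<and> i < j \<and> \<sigma> i > \<sigma> j}"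
  have inj: "inj_on \<sigma> {Suc a..<b}"
    using Suc.prems by (rule inj_on_subset) auto
  have IH: "eps t (map \<sigma> [Suc a..<b]) = t ^ inv_count {Suc a..<b} \<sigma>"
    using Suc.hyps inj by simp
  \<comment> \<open>Inversions split into those whose first position is \<open>a\<close>, counted by
    the head of the word, and those inside the remaining interval.\<close>
  have "?P a = Pair a ` ?J \<union> ?P (Suc a)"
  proof (intro subset_antisym subsetI)
    fix q assume "q \<in> ?P a"
    then show "q \<in> Pair a ` ?J \<union> ?P (Suc a)"
      by (cases q; cases "fst q = a") auto
  next
    fix q assume "q \<in> Pair a ` ?J \<union> ?P (Suc a)"
    then show "q \<in> ?P a" using ab by auto
  qed
  moreover have "finite (?P (Suc a))"
    by (rule finite_subset[of _ "{Suc a..<b} \<times> {Suc a..<b}"]) auto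
  moreover have "card (Pair a ` ?J \<union> ?P (Suc a)) = card (Pair a ` ?J) + card (?P (Suc a))"
    by (rule card_Un_disjoint) (use calculation(2) in auto)
  ultimately have "card (?P a) = card (Pair a ` ?J) + card (?P (Suc a))"
    by simp
  then have inv: "inv_count {a..<b} \<sigma> = card ?J + inv_count {Suc a..<b} \<sigma>"
    by (simp add: inv_count_def card_image inj_on_def)
  have "distinct (filter (\<lambda>j. \<sigma> j < \<sigma> a) [Suc a..<b])" by simp
  from distinct_card[OF this]
  have "length (filter (\<lambda>y. y < \<sigma> a) (map \<sigma> [Suc a..<b])) = card ?J"
    by (simp add: filter_map o_def)
  moreover have "\<sigma> a \<notin> set (map \<sigma> [Suc a..<b])"
    using Suc.prems ab by (auto dest: inj_onD)
  moreover have "map \<sigma> [a..<b] = \<sigma> a # map \<sigma> [Suc a..<b]"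
    using ab by (simp add: upt_conv_Cons)
  ultimately show ?case
    using IH by (simp only: eps.simps inv power_add if_False mult.assoc)
qed

section \<open>Quantum integers and factorials as generating functions\<close>

lemma sum_power_rank:
  fixes S :: "nat set"
  assumes "finite S"
  shows "(\<Sum>x\<in>S. t ^ card {y\<in>S. y < x}) = qint t (card S)"
  using assms
proof (induction rule: finite_linorder_max_induct)
  case empty
  then show ?case by (simp add: qint_def)
next
  case (insert b A)
  have "b \<notin> A" using insert by auto
  \<comment> \<open>The new maximum \<open>b\<close> has rank \<open>card A\<close>, which is the
    next exponent in \<open>qint\<close>; the ranks of the old elements do not change.\<close>
  have "{y \<in> insert b A. y < b} = A" using insert by auto
  moreover have "{y \<in> insert b A. y < x} = {y \<in> A. y < x}" if "x \<in> A" for x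
    using that insert by force
  ultimately show ?case
    using insert \<open>b \<notin> A\<close> by (simp add: qint_def)
qed

text \<open>Only arrangements of \<open>S\<close> without repetition contribute, so this is the
  generating function of inversions over permutations. Splitting off the first letter, its rank in
  \<open>S\<close> is the number of inversions that it starts.\<close>

lemma sum_eps:
  assumes "finite S"
  shows "(\<Sum>w\<in>words (card S) S. eps t w) = qfact t (card S)"
  using assms
proof (induction "card S" arbitrary: S)
  case 0
  then show ?case by (simp add: words_0 qfact_def)
next
  case (Suc n)
  note fin = \<open>finite S\<close>
  have step: "(\<Sum>w\<in>words n S. eps t (x # w)) = t ^ card {y\<in>S. y < x} * qfact t n"
    if x: "x \<in> S" for x
  proof -
    have card: "card (S - {x}) = n"
      using Suc.hyps(2) x fin by simp
    \<comment> \<open>A tail containing \<open>x\<close> again makes \<open>eps\<close> vanish, so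
      the letter \<open>x\<close> may be removed from the alphabet.\<close>
    have "(\<Sum>w\<in>words n S. eps t (x # w)) = (\<Sum>w\<in>words n (S - {x}). eps t (x # w))"
      by (rule sum.mono_neutral_right) (use fin in \<open>auto simp: finite_words\<close>, auto simp: words_def)
    also have "\<dots> = (\<Sum>w\<in>words n (S - {x}). t ^ card {y\<in>S. y < x} * eps t w)"
    proof (rule sum.cong[OF refl])
      fix w assume w: "w \<in> words n (S - {x})"
      show "eps t (x # w) = t ^ card {y\<in>S. y < x} * eps t w"
      proof (cases "distinct w")
        case True
        \<comment> \<open>A repetition-free tail of this length exhausts \<open>S - {x}\<close>, so
          the number of its letters below \<open>x\<close> is the rank of \<open>x\<close> in
          \<open>S\<close>.\<close>
        then have "set w = S - {x}"
          using w card fin by (intro card_subset_eq) (auto simp: words_def distinct_card)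
        moreover have "length (filter (\<lambda>y. y < x) w) = card {y\<in>set w. y < x}"
          using True by (metis distinct_card distinct_filter set_filter)
        moreover have "{y \<in> S - {x}. y < x} = {y\<in>S. y < x}" by auto
        ultimately show ?thesis by simp
      qed (simp add: eps_not_distinct)
    qed
    finally show ?thesis
      using Suc.hyps(1)[of "S - {x}"] card fin by (simp flip: sum_distrib_left)
  qed
  have "(\<Sum>w\<in>words (Suc n) S. eps t w) = (\<Sum>x\<in>S. t ^ card {y\<in>S. y < x} * qfact t n)"
    using step by (simp add: sum_words_Suc fin)
  also have "\<dots> = qint t (Suc n) * qfact t n"
    using sum_power_rank[OF fin] Suc.hyps(2) by (simp flip: sum_distrib_right)
  also have "\<dots> = qfact t (Suc n)"
    by (simp add: qfact_def)
  finally show ?case using Suc.hyps(2) by simp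
qed

text \<open>A vanishing factor \<open>qint u k\<close> would give \<open>u ^ k = 1\<close>, since
  \<open>u ^ k - 1\<close> is \<open>u - 1\<close> times that factor.\<close>

lemma qfact_nonzero:
  assumes "\<not> root_of_unity u"
  shows "qfact u n \<noteq> 0"
proof -
  have "qint u k \<noteq> 0" if "k \<ge> 1" for k
  proof
    assume "qint u k = 0"
    then have "u ^ k = 1"
      using power_diff_1_eq[of u k] by (simp add: qint_def)
    moreover have "k > 0" using that by simp
    ultimately show False
      using assms unfolding root_of_unity_def by blast
  qed
  then show ?thesis by (auto simp: qfact_def)
qed

lemma top_word:
  assumes "w \<in> words n {1..n}" "distinct w"
  shows "sort w = [1..<n + 1]"
proof -
  have "set w = {1..n}"
    using assms distinct_card[OF assms(2)] by (intro card_subset_eq) (simp_all add: words_def)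
  moreover have "set [1..<n + 1] = {1..n}" by auto
  ultimately have "set (sort w) = set [1..<n + 1]" by (simp only: set_sort)
  then show ?thesis
    using assms(2) by (intro sorted_distinct_set_unique) (simp_all only: sorted_sort sorted_upt
        distinct_sort distinct_upt)
qed

subsection \<open>Pfaffian permutations as words\<close>

lemma map_pairs_upt:
  "concat (map (\<lambda>k. [f (2 * k - 1), f (2 * k)]) [1..<n + 1]) = map f [1..<2 * n + 1]"
  by (induction n) simp_all

text \<open>Cutting the word of values of a permutation into pairs identifies
  \<open>pf_perms n\<close> with the lists of increasing pairs whose entries are all distinct. The
  remaining lists have coefficient 0, which is why \<open>f\<close> must vanish there.\<close>

lemma sum_pf_perms:
  fixes f :: "(nat \<times> nat) list \<Rightarrow> complex \<Rightarrow> 'a::comm_monoid_add"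
  assumes f0: "\<And>ps. f ps 0 = 0"
  shows "(\<Sum>\<sigma>\<in>pf_perms n. f (map (\<lambda>k. (\<sigma> (2 * k - 1), \<sigma> (2 * k))) [1..<n + 1])
        (t ^ inv_count {1..2 * n} \<sigma>)) =
    (\<Sum>ps\<in>words n {(k, l). k \<in> {1..2 * n} \<and> l \<in> {1..2 * n} \<and> k < l}.
        f ps (eps t (concat (map pair_list ps))))"
proof -
  let ?L = "\<lambda>\<sigma>. map (\<lambda>k. (\<sigma> (2 * k - 1), \<sigma> (2 * k))) [1..<n + 1]"
  let ?T = "{(k, l). k \<in> {1..2 * n} \<and> l \<in> {1..2 * n} \<and> k < l}"
  let ?flat = "\<lambda>ps. concat (map pair_list ps)"
  have fin: "finite ?T"
    by (rule finite_subset[of _ "{1..2 * n} \<times> {1..2 * n}"]) auto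
  have flat: "?flat (?L \<sigma>) = map \<sigma> [1..<2 * n + 1]" for \<sigma> :: "nat \<Rightarrow> nat"
    using map_pairs_upt[of \<sigma> n] by (simp add: o_def)
  have len: "length (?flat ps) = 2 * length ps" for ps :: "(nat \<times> nat) list"
    by (induction ps) auto
  have flat_inj: "ps = qs" if "?flat ps = ?flat qs" for ps qs :: "(nat \<times> nat) list"
    using that
  proof (induction ps arbitrary: qs)
    case Nil
    then show ?case by (cases qs) auto
  next
    case (Cons p ps)
    then show ?case by (cases qs; cases p) auto
  qed
  have bij: "bij_betw ?L (pf_perms n) {ps \<in> words n ?T. distinct (?flat ps)}"
  proof (rule bij_betw_imageI)
    show "inj_on ?L (pf_perms n)"
    proof (rule inj_onI)
      fix \<sigma> \<tau> assume \<sigma>: "\<sigma> \<in> pf_perms n" and \<tau>: "\<tau> \<in> pf_perms n" and eq: "?L \<sigma> = ?L \<tau>"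
      have "map \<sigma> [1..<2 * n + 1] = map \<tau> [1..<2 * n + 1]"
        using flat[of \<sigma>] flat[of \<tau>] eq by metis
      then have "\<sigma> i = \<tau> i" if "i \<in> {1..2 * n}" for i
        using that by (auto simp: map_eq_conv simp del: upt_Suc)
      moreover have "\<sigma> i = \<tau> i" if "i \<notin> {1..2 * n}" for i
      proof -
        have "\<sigma> permutes {1..2 * n}" "\<tau> permutes {1..2 * n}"
          using \<sigma> \<tau> by (simp_all add: pf_perms_def)
        then show ?thesis using that by (simp add: permutes_not_in)
      qed
      ultimately show "\<sigma> = \<tau>" by blast
    qed
    show "?L ` pf_perms n = {ps \<in> words n ?T. distinct (?flat ps)}"
    proof (intro subset_antisym image_subsetI subsetI)
      fix \<sigma> assume "\<sigma> \<in> pf_perms n"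
      then have p: "\<sigma> permutes {1..2 * n}" and lt: "\<forall>i\<in>{1..n}. \<sigma> (2 * i - 1) < \<sigma> (2 * i)"
        by (auto simp: pf_perms_def)
      have "\<sigma> i \<in> {1..2 * n}" if "i \<in> {1..2 * n}" for i
        using p that by (simp only: permutes_in_image)
      moreover have "2 * k - 1 \<in> {1..2 * n}" "2 * k \<in> {1..2 * n}" if "k \<in> {1..n}" for k
        using that by auto
      moreover have "set [1..<n + 1] = {1..n}" by auto
      ultimately have "set (?L \<sigma>) \<subseteq> ?T"
        using lt unfolding set_map by blast
      then have "?L \<sigma> \<in> words n ?T"
        by (simp add: words_def)
      moreover have "distinct (?flat (?L \<sigma>))"
        unfolding flat using permutes_inj_on[OF p] by (simp add: distinct_map)
      ultimately show "?L \<sigma> \<in> {ps \<in> words n ?T. distinct (?flat ps)}" by blast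
    next
      fix ps assume "ps \<in> {ps \<in> words n ?T. distinct (?flat ps)}"
      then have ps: "length ps = n" "set ps \<subseteq> ?T" and d: "distinct (?flat ps)"
        by (auto simp: words_def)
      let ?w = "?flat ps"
      have lw: "length ?w = 2 * n" using ps len by simp
      have "set ?w \<subseteq> {1..2 * n}" using ps(2) by fastforce
      then have sw: "set ?w = {1..2 * n}"
        by (rule card_subset_eq[OF finite_atLeastAtMost])
          (simp only: distinct_card[OF d] lw card_atLeastAtMost diff_Suc_1)
      \<comment> \<open>The permutation is read off the flattened word: the shift by one reconciles
        values starting at 1 with list positions starting at 0, and points out of range are
        fixed.\<close>
      define \<sigma> where "\<sigma> i = (if i \<in> {1..2 * n} then ?w ! (i - 1) else i)" for i
      have m: "map \<sigma> [1..<2 * n + 1] = ?w"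
        using lw by (intro nth_equalityI) (auto simp: \<sigma>_def simp del: upt_Suc)
      have "bij_betw \<sigma> {1..2 * n} {1..2 * n}"
      proof -
        have e: "set [1..<2 * n + 1] = {1..2 * n}" by auto
        have "distinct (map \<sigma> [1..<2 * n + 1])" using d m by simp
        then have "inj_on \<sigma> {1..2 * n}" unfolding distinct_map e by blast
        moreover have "\<sigma> ` {1..2 * n} = {1..2 * n}"
          using sw m e by (metis set_map)
        ultimately show ?thesis by (simp add: bij_betw_def)
      qed
      then have p: "\<sigma> permutes {1..2 * n}"
        by (intro bij_imp_permutes) (auto simp: \<sigma>_def)
      have L: "?L \<sigma> = ps" using flat[of \<sigma>] m flat_inj by metis
      have "\<sigma> (2 * i - 1) < \<sigma> (2 * i)" if "i \<in> {1..n}" for i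
      proof -
        have "(\<sigma> (2 * i - 1), \<sigma> (2 * i)) \<in> set (?L \<sigma>)"
          unfolding set_map using that by (intro imageI) auto
        then have "(\<sigma> (2 * i - 1), \<sigma> (2 * i)) \<in> ?T"
          unfolding L using ps(2) by blast
        then show ?thesis by simp
      qed
      then have "\<sigma> \<in> pf_perms n" using p by (simp add: pf_perms_def)
      then show "ps \<in> ?L ` pf_perms n" using L by blast
    qed
  qed
  have "(\<Sum>\<sigma>\<in>pf_perms n. f (?L \<sigma>) (t ^ inv_count {1..2 * n} \<sigma>)) =
      (\<Sum>\<sigma>\<in>pf_perms n. f (?L \<sigma>) (eps t (?flat (?L \<sigma>))))"
  proof (rule sum.cong[OF refl])
    fix \<sigma> assume "\<sigma> \<in> pf_perms n"
    then have "inj_on \<sigma> {1..<2 * n + 1}"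
      unfolding pf_perms_def using permutes_inj_on by blast
    from eps_map[OF this] have "eps t (?flat (?L \<sigma>)) = t ^ inv_count {1..<2 * n + 1} \<sigma>"
      unfolding flat .
    moreover have "{1..<2 * n + 1} = {1..2 * n}" by auto
    ultimately show "f (?L \<sigma>) (t ^ inv_count {1..2 * n} \<sigma>) = f (?L \<sigma>) (eps t (?flat (?L \<sigma>)))"
      by simp
  qed
  also have "\<dots> = (\<Sum>ps\<in>{ps \<in> words n ?T. distinct (?flat ps)}. f ps (eps t (?flat ps)))"
    by (rule sum.reindex_bij_betw[OF bij])
  also have "\<dots> = (\<Sum>ps\<in>words n ?T. f ps (eps t (?flat ps)))"
    by (rule sum.mono_neutral_left[OF finite_words[OF fin]]) (auto simp: eps_not_distinct f0)
  finally show ?thesis .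
qed

subsection \<open>Alternating functions of words modulo an ideal\<close>

locale central_scalars =
  fixes sc :: "complex \<Rightarrow> 'a::ring_1"
  assumes sc_add: "sc (c + d) = sc c + sc d"
    and sc_mult: "sc (c * d) = sc c * sc d"
    and sc_1 [simp]: "sc 1 = 1"
    and sc_comm: "x * sc c = sc c * x"
begin

lemma sc_0 [simp]: "sc 0 = 0"
  using sc_add[of 0 0] by simp

lemma sc_minus: "sc (- c) = - sc c"
  using sc_add[of "- c" c] by (simp add: eq_neg_iff_add_eq_0)

lemma sc_diff: "sc (c - d) = sc c - sc d"
  using sc_add[of c "- d"] by (simp add: sc_minus)

lemma sc_sum: "sc (sum f A) = (\<Sum>x\<in>A. sc (f x))"
  by (induction A rule: infinite_finite_induct) (simp_all add: sc_add)

lemma sc_sc: "sc c * (sc d * x) = sc (c * d) * x"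
  by (simp add: sc_mult mult.assoc)

lemma sc_left_commute: "x * (sc c * y) = sc c * (x * y)"
  by (metis mult.assoc sc_comm)

text \<open>The diagonal drops out, and each term with its indices in decreasing order is folded
  onto the term with the indices exchanged, at the cost of a factor \<open>t\<close>.\<close>

lemma sum_antisym:
  fixes S :: "nat set"
  assumes diag: "\<And>k. e k k = 0" and swap: "\<And>k l. k < l \<Longrightarrow> e l k = t * e k l"
  shows "(\<Sum>k\<in>S. \<Sum>l\<in>S. sc (e k l) * f k l) =
    (\<Sum>k\<in>S. \<Sum>l\<in>S. if k < l then sc (e k l) * (f k l + sc t * f l k) else 0)"
proof -
  let ?F = "\<lambda>k l. if k < l then sc (e k l) * f k l else 0"
  let ?G = "\<lambda>k l. if k < l then sc (e l k) * f l k else 0"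
  have "(\<Sum>k\<in>S. \<Sum>l\<in>S. sc (e k l) * f k l) = (\<Sum>k\<in>S. \<Sum>l\<in>S. ?F k l + ?G l k)"
    by (intro sum.cong refl) (auto simp: diag not_less_iff_gr_or_eq)
  also have "\<dots> = (\<Sum>k\<in>S. \<Sum>l\<in>S. ?F k l) + (\<Sum>k\<in>S. \<Sum>l\<in>S. ?G l k)"
    by (simp add: sum.distrib)
  also have "(\<Sum>k\<in>S. \<Sum>l\<in>S. ?G l k) = (\<Sum>k\<in>S. \<Sum>l\<in>S. ?G k l)"
    by (rule sum.swap)
  also have "(\<Sum>k\<in>S. \<Sum>l\<in>S. ?F k l) + \<dots> = (\<Sum>k\<in>S. \<Sum>l\<in>S. ?F k l + ?G k l)"
    by (simp add: sum.distrib)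
  also have "\<dots> = (\<Sum>k\<in>S. \<Sum>l\<in>S. if k < l then sc (e k l) * (f k l + sc t * f l k) else 0)"
    by (intro sum.cong refl) (auto simp: swap distrib_left sc_sc mult.commute)
  finally show ?thesis .
qed

text \<open>Each pair of neighbouring letters is folded separately, which turns products of entries
  into 2 by 2 minors. The prefix \<open>u\<close> is there for the induction, because
  \<open>eps\<close> of a concatenation does not factor.\<close>

lemma sum_words_ordered_pairs:
  fixes S :: "nat set"
  assumes "finite S"
  shows "(\<Sum>ps\<in>words n (S \<times> S). sc (eps t (u @ concat (map pair_list ps))) *
      prod_list (map (\<lambda>(k, l). c k l) ps)) =
    (\<Sum>ps\<in>words n {(k, l). k \<in> S \<and> l \<in> S \<and> k < l}.
      sc (eps t (u @ concat (map pair_list ps))) *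
      prod_list (map (\<lambda>(k, l). c k l + sc t * c l k) ps))"
proof (induction n arbitrary: u)
  case 0
  then show ?case by (simp add: words_0)
next
  case (Suc n)
  let ?T = "{(k, l). k \<in> S \<and> l \<in> S \<and> k < l}"
  let ?flat = "\<lambda>ps. concat (map pair_list ps)"
  let ?c = "\<lambda>ps. prod_list (map (\<lambda>(k, l). c k l) ps)"
  let ?b = "\<lambda>ps. prod_list (map (\<lambda>(k, l). c k l + sc t * c l k) ps)"
  have fT: "finite ?T"
    by (rule finite_subset[of _ "S \<times> S"]) (use assms in auto)
  have "(\<Sum>ps\<in>words (Suc n) (S \<times> S). sc (eps t (u @ ?flat ps)) * ?c ps) =
    (\<Sum>k\<in>S. \<Sum>l\<in>S. c k l *
      (\<Sum>ps\<in>words n (S \<times> S). sc (eps t ((u @ [k, l]) @ ?flat ps)) * ?c ps))"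
    by (simp add: sum_words_Suc assms sum_Times sum_distrib_left sc_left_commute)
  also have "\<dots> = (\<Sum>k\<in>S. \<Sum>l\<in>S. c k l *
      (\<Sum>ps\<in>words n ?T. sc (eps t ((u @ [k, l]) @ ?flat ps)) * ?b ps))"
    unfolding Suc.IH ..
  also have "\<dots> = (\<Sum>k\<in>S. \<Sum>l\<in>S. \<Sum>ps\<in>words n ?T.
      sc (eps t (u @ k # l # ?flat ps)) * (c k l * ?b ps))"
    by (simp add: sum_distrib_left sc_left_commute)
  also have "\<dots> = (\<Sum>k\<in>S. \<Sum>ps\<in>words n ?T. \<Sum>l\<in>S.
      sc (eps t (u @ k # l # ?flat ps)) * (c k l * ?b ps))"
    by (intro sum.cong refl sum.swap)
  also have "\<dots> = (\<Sum>ps\<in>words n ?T. \<Sum>k\<in>S. \<Sum>l\<in>S.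
      sc (eps t (u @ k # l # ?flat ps)) * (c k l * ?b ps))"
    by (rule sum.swap)
  \<comment> \<open>With the tail \<open>ps\<close> fixed, only the two letters between
    \<open>u\<close> and the flattened tail vary, so \<open>eps_dup\<close> and
    \<open>eps_swap\<close> provide the antisymmetry.\<close>
  also have "\<dots> = (\<Sum>ps\<in>words n ?T. \<Sum>k\<in>S. \<Sum>l\<in>S. if k < l then
      sc (eps t (u @ k # l # ?flat ps)) * (c k l * ?b ps + sc t * (c l k * ?b ps)) else 0)"
    by (intro sum.cong refl sum_antisym eps_dup eps_swap)
  also have "\<dots> = (\<Sum>ps\<in>words n ?T. \<Sum>q\<in>S \<times> S. if fst q < snd q then
      sc (eps t (u @ ?flat (q # ps))) * ?b (q # ps) else 0)"
    unfolding sum_Times by (intro sum.cong refl) (simp add: distrib_right mult.assoc)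
  also have "\<dots> = (\<Sum>ps\<in>words n ?T. \<Sum>q\<in>?T. sc (eps t (u @ ?flat (q # ps))) * ?b (q # ps))"
    by (intro sum.cong refl sum.mono_neutral_cong_right) (use assms in auto)
  also have "\<dots> = (\<Sum>q\<in>?T. \<Sum>ps\<in>words n ?T. sc (eps t (u @ ?flat (q # ps))) * ?b (q # ps))"
    by (rule sum.swap)
  also have "\<dots> = (\<Sum>ps\<in>words (Suc n) ?T. sc (eps t (u @ ?flat ps)) * ?b ps)"
    by (rule sum_words_Suc[OF fT, symmetric])
  finally show ?case .
qed

text \<open>The Pfaffian before division by the quantum factorial, formed in a ring of
  representatives rather than in the quotient.\<close>

definition pf_sum :: "complex \<Rightarrow> nat \<Rightarrow> (nat \<Rightarrow> nat \<Rightarrow> 'a) \<Rightarrow> 'a" where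
  "pf_sum v n b = (\<Sum>\<sigma>\<in>pf_perms n. sc ((- v) ^ inv_count {1..2 * n} \<sigma>) *
     prod_list (map (\<lambda>k. b (\<sigma> (2 * k - 1)) (\<sigma> (2 * k))) [1..<n + 1]))"

lemma pf_sum_words:
  "pf_sum v n b = (\<Sum>ps\<in>words n {(k, l). k \<in> {1..2 * n} \<and> l \<in> {1..2 * n} \<and> k < l}.
     sc (eps (- v) (concat (map pair_list ps))) * prod_list (map (\<lambda>(k, l). b k l) ps))"
proof -
  let ?f = "\<lambda>ps c. sc c * prod_list (map (\<lambda>(k, l). b k l) ps)"
  have "pf_sum v n b = (\<Sum>\<sigma>\<in>pf_perms n.
      ?f (map (\<lambda>k. (\<sigma> (2 * k - 1), \<sigma> (2 * k))) [1..<n + 1]) ((- v) ^ inv_count {1..2 * n} \<sigma>))"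
    by (simp add: pf_sum_def o_def)
  also have "\<dots> = (\<Sum>ps\<in>words n {(k, l). k \<in> {1..2 * n} \<and> l \<in> {1..2 * n} \<and> k < l}.
      ?f ps (eps (- v) (concat (map pair_list ps))))"
    by (rule sum_pf_perms) simp
  finally show ?thesis .
qed

text \<open>
  For \<open>is\<close> of length \<open>N\<close>, \<open>row_det t N a is\<close> is the coefficient of \<open>x\<^sub>1 \<cdots> x\<^sub>N\<close> in \<open>y\<^sub>i \<cdots> y\<^sub>j\<close>, the letters
  \<open>i, \<dots>, j\<close> running through the word \<open>is\<close> and \<open>y\<^sub>i\<close> being the form \<open>a\<^sub>i\<^sub>1 x\<^sub>1 + \<cdots> + a\<^sub>i\<^sub>N x\<^sub>N\<close>
  in the quantum exterior algebra underlying \<open>eps\<close>.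
\<close>

definition row_det :: "complex \<Rightarrow> nat \<Rightarrow> (nat \<Rightarrow> nat \<Rightarrow> 'a) \<Rightarrow> nat list \<Rightarrow> 'a" where
  "row_det t N a is =
     (\<Sum>js\<in>words (length is) {1..N}. sc (eps t js) * prod_list (map2 a is js))"

text \<open>Isolates two neighbouring rows, so that a relation between them can be applied to the
  inner double sum alone.\<close>

lemma row_det_split:
  "row_det t N a (u @ i # j # v) =
    (\<Sum>x\<in>words (length u) {1..N}. \<Sum>y\<in>words (length v) {1..N}. prod_list (map2 a u x) *
      (\<Sum>k\<in>{1..N}. \<Sum>l\<in>{1..N}. sc (eps t (x @ k # l # y)) * (a i k * a j l)) *
      prod_list (map2 a v y))"
proof -
  let ?S = "{1..N}"
  let ?h = "\<lambda>x k l y. sc (eps t (x @ k # l # y)) *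
      (prod_list (map2 a u x) * (a i k * a j l) * prod_list (map2 a v y))"
  have "row_det t N a (u @ i # j # v) =
      (\<Sum>x\<in>words (length u) ?S. \<Sum>k\<in>?S. \<Sum>l\<in>?S. \<Sum>y\<in>words (length v) ?S.
        sc (eps t (x @ k # l # y)) * prod_list (map2 a (u @ i # j # v) (x @ k # l # y)))"
  proof -
    have "length (u @ i # j # v) = length u + Suc (Suc (length v))" by simp
    then show ?thesis
      by (simp only: row_det_def sum_words_add sum_words_Suc finite_atLeastAtMost)
  qed
  also have "\<dots> = (\<Sum>x\<in>words (length u) ?S. \<Sum>k\<in>?S. \<Sum>l\<in>?S. \<Sum>y\<in>words (length v) ?S. ?h x k l y)"
    by (intro sum.cong refl) (simp add: words_def mult.assoc)
  also have "\<dots> = (\<Sum>x\<in>words (length u) ?S. \<Sum>k\<in>?S. \<Sum>y\<in>words (length v) ?S. \<Sum>l\<in>?S. ?h x k l y)"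
    by (intro sum.cong refl sum.swap)
  also have "\<dots> = (\<Sum>x\<in>words (length u) ?S. \<Sum>y\<in>words (length v) ?S. \<Sum>k\<in>?S. \<Sum>l\<in>?S. ?h x k l y)"
    by (intro sum.cong refl sum.swap)
  finally show ?thesis
    by (simp add: sum_distrib_left sum_distrib_right sc_left_commute mult.assoc)
qed

text \<open>Both sides are the same double sum over row words and column words. The factors are
  ordered by position in the words, so exchanging rows and columns moves no factor past
  another.\<close>

lemma sum_row_det_transpose:
  "(\<Sum>is\<in>words n {1..N}. sc (eps t' is) * row_det t N a is) =
    (\<Sum>js\<in>words n {1..N}. sc (eps t js) * row_det t' N (\<lambda>i j. a j i) js)"
proof -
  have "prod_list (map2 a is js) = prod_list (map2 (\<lambda>i j. a j i) js is)" for "is" js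
    by (induction "is" js rule: list_induct2') auto
  then have "(\<Sum>is\<in>words n {1..N}. sc (eps t' is) * row_det t N a is) =
    (\<Sum>is\<in>words n {1..N}. \<Sum>js\<in>words n {1..N}.
      sc (eps t js) * (sc (eps t' is) * prod_list (map2 (\<lambda>i j. a j i) js is)))"
    by (intro sum.cong refl)
      (auto simp: row_det_def words_def sum_distrib_left sc_sc mult.commute)
  also have "\<dots> = (\<Sum>js\<in>words n {1..N}. \<Sum>is\<in>words n {1..N}.
      sc (eps t js) * (sc (eps t' is) * prod_list (map2 (\<lambda>i j. a j i) js is)))"
    by (rule sum.swap)
  also have "\<dots> = (\<Sum>js\<in>words n {1..N}. sc (eps t js) * row_det t' N (\<lambda>i j. a j i) js)"
    by (intro sum.cong refl) (auto simp: row_det_def words_def sum_distrib_left)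
  finally show ?thesis .
qed

text \<open>The two expansions of the power of \<open>\<Omega>\<close>: by the
  \<open>\<omega>\<^sub>m\<close> on the left, by pairs of columns on the right. It is an identity
  in the ring itself, before any reduction modulo an ideal.\<close>

lemma sum_row_det_pairs:
  "(\<Sum>ms\<in>words n {1..n}. row_det (- v) (2 * n) a (concat (map (\<lambda>m. [2 * m - 1, 2 * m]) ms))) =
    pf_sum v n (\<lambda>k l. \<Sum>m\<in>{1..n}. a (2 * m - 1) k * a (2 * m) l - sc v * (a (2 * m - 1) l * a (2 * m) k))"
proof -
  let ?S = "{1..2 * n}" and ?M = "{1..n}"
  let ?rows = "\<lambda>ms. concat (map (\<lambda>m. [2 * m - 1, 2 * m]) ms)"
  let ?flat = "\<lambda>ps. concat (map pair_list ps)"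
  let ?g = "\<lambda>m (k, l). a (2 * m - 1) k * a (2 * m) l"
  define c where "c k l = (\<Sum>m\<in>?M. a (2 * m - 1) k * a (2 * m) l)" for k l
  have pair: "prod_list (map2 a (?rows ms) (?flat ps)) = prod_list (map2 ?g ms ps)"
    if "length ms = length ps" for ms :: "nat list" and ps :: "(nat \<times> nat) list"
    using that by (induction ms ps rule: list_induct2) (auto simp: mult.assoc)
  have len: "length (?rows ms) = 2 * length ms" for ms :: "nat list"
    by (induction ms) auto
  have "(\<Sum>ms\<in>words n ?M. row_det (- v) (2 * n) a (?rows ms)) =
      (\<Sum>ms\<in>words n ?M. \<Sum>ps\<in>words n (?S \<times> ?S). sc (eps (- v) (?flat ps)) * prod_list (map2 ?g ms ps))"
  proof (intro sum.cong refl)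
    fix ms assume "ms \<in> words n ?M"
    then have ms: "length ms = n" by (simp add: words_def)
    have "row_det (- v) (2 * n) a (?rows ms) = (\<Sum>js\<in>words (2 * n) ?S.
        sc (eps (- v) js) * prod_list (map2 a (?rows ms) js))"
      by (simp only: row_det_def len ms)
    also have "\<dots> = (\<Sum>ps\<in>words n (?S \<times> ?S).
        sc (eps (- v) (?flat ps)) * prod_list (map2 a (?rows ms) (?flat ps)))"
      by (rule sum_words_pairs) simp
    also have "\<dots> = (\<Sum>ps\<in>words n (?S \<times> ?S).
        sc (eps (- v) (?flat ps)) * prod_list (map2 ?g ms ps))"
      by (intro sum.cong refl arg_cong2[of _ _ _ _ "(*)"] pair) (simp add: ms words_def)
    finally show "row_det (- v) (2 * n) a (?rows ms) = \<dots>" .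
  qed
  also have "\<dots> = (\<Sum>ps\<in>words n (?S \<times> ?S). \<Sum>ms\<in>words n ?M.
      sc (eps (- v) (?flat ps)) * prod_list (map2 ?g ms ps))"
    by (rule sum.swap)
  \<comment> \<open>For a fixed list of column pairs, the choices of \<open>m\<close> at the
    different positions are independent, so distributivity collects them into the factors
    \<open>c k l\<close>.\<close>
  also have "\<dots> = (\<Sum>ps\<in>words n (?S \<times> ?S).
      sc (eps (- v) ([] @ ?flat ps)) * prod_list (map (\<lambda>(k, l). c k l) ps))"
  proof (intro sum.cong refl)
    fix ps assume "ps \<in> words n (?S \<times> ?S)"
    then have "length ps = n" by (simp add: words_def)
    from sum_words_prod_list[OF finite_atLeastAtMost, where ps = ps, unfolded this]
    have "(\<Sum>ms\<in>words n ?M. prod_list (map2 ?g ms ps)) =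
        prod_list (map (\<lambda>p. \<Sum>m\<in>?M. ?g m p) ps)"
      .
    also have "(\<lambda>p. \<Sum>m\<in>?M. ?g m p) = (\<lambda>(k, l). c k l)"
      by (auto simp: c_def)
    finally show "(\<Sum>ms\<in>words n ?M. sc (eps (- v) (?flat ps)) * prod_list (map2 ?g ms ps)) =
        sc (eps (- v) ([] @ ?flat ps)) * prod_list (map (\<lambda>(k, l). c k l) ps)"
      by (simp flip: sum_distrib_left)
  qed
  also have "\<dots> = (\<Sum>ps\<in>words n {(k, l). k \<in> ?S \<and> l \<in> ?S \<and> k < l}.
      sc (eps (- v) ([] @ ?flat ps)) * prod_list (map (\<lambda>(k, l). c k l + sc (- v) * c l k) ps))"
    by (rule sum_words_ordered_pairs) simp
  also have "\<dots> = pf_sum v n (\<lambda>k l. c k l + sc (- v) * c l k)"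
    by (simp add: pf_sum_words)
  finally show ?thesis
    by (simp add: c_def sc_minus sum_distrib_left sum_subtractf sum_negf)
qed

end

text \<open>Here \<open>I\<close> is only a linear subspace. Multiplication by matrix entries is
  added in \<open>quantum_matrix\<close>, with indices in range, because the ideal of the quantum
  semigroup is defined as an ideal of the subalgebra on those letters.\<close>

locale scalar_ideal = central_scalars +
  fixes I :: "'a set"
  assumes I_0: "0 \<in> I"
    and I_add: "x \<in> I \<Longrightarrow> y \<in> I \<Longrightarrow> x + y \<in> I"
    and I_sc: "x \<in> I \<Longrightarrow> sc c * x \<in> I"
begin

definition cong :: "'a \<Rightarrow> 'a \<Rightarrow> bool" (infix "\<approx>" 50) where
  "x \<approx> y \<longleftrightarrow> x - y \<in> I"

lemma I_sum: "(\<And>x. x \<in> A \<Longrightarrow> f x \<in> I) \<Longrightarrow> sum f A \<in> I"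
  by (induction A rule: infinite_finite_induct) (simp_all add: I_0 I_add)

lemma cong_refl [simp]: "x \<approx> x"
  by (simp add: cong_def I_0)

lemma cong_sym: "x \<approx> y \<Longrightarrow> y \<approx> x"
  using I_sc[of "x - y" "-1"] by (simp add: cong_def sc_minus)

lemma cong_trans [trans]: "x \<approx> y \<Longrightarrow> y \<approx> z \<Longrightarrow> x \<approx> z"
  using I_add[of "x - y" "y - z"] by (simp add: cong_def)

lemma cong_sc: "x \<approx> y \<Longrightarrow> sc c * x \<approx> sc c * y"
  using I_sc[of "x - y" c] by (simp add: cong_def right_diff_distrib)

lemma cong_sum: "(\<And>x. x \<in> A \<Longrightarrow> f x \<approx> g x) \<Longrightarrow> sum f A \<approx> sum g A"
  unfolding cong_def by (simp add: I_sum flip: sum_subtractf)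

text \<open>Models the dependence of a monomial in quantum exterior variables on its word. The
  alphabet \<open>S\<close> is explicit since the matrix relations are given only for indices in
  range.\<close>

definition alternating :: "nat set \<Rightarrow> complex \<Rightarrow> (nat list \<Rightarrow> 'a) \<Rightarrow> bool" where
  "alternating S t F \<longleftrightarrow>
    (\<forall>u i j v. i < j \<longrightarrow> set (u @ i # j # v) \<subseteq> S \<longrightarrow>
       F (u @ j # i # v) \<approx> sc t * F (u @ i # j # v)) \<and>
    (\<forall>u i v. set (u @ i # i # v) \<subseteq> S \<longrightarrow> F (u @ i # i # v) \<approx> 0)"

lemma alternating_swap:
  "alternating S t F \<Longrightarrow> i < j \<Longrightarrow> set (u @ i # j # v) \<subseteq> S \<Longrightarrow>
    F (u @ j # i # v) \<approx> sc t * F (u @ i # j # v)"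
  unfolding alternating_def by blast

lemma alternating_dup:
  "alternating S t F \<Longrightarrow> set (u @ i # i # v) \<subseteq> S \<Longrightarrow> F (u @ i # i # v) \<approx> 0"
  unfolding alternating_def by blast

text \<open>The letter \<open>x\<close> moves right through the sorted word: each smaller letter
  passed costs a factor \<open>t\<close>, and meeting an equal letter gives 0.\<close>

lemma alternating_insort:
  assumes F: "alternating S t F"
    and "sorted ys" "set (u @ x # ys) \<subseteq> S"
  shows "F (u @ x # ys) \<approx>
    sc (if x \<in> set ys then 0 else t ^ length (filter (\<lambda>y. y < x) ys)) * F (u @ insort x ys)"
  using assms(2,3)
proof (induction ys arbitrary: u)
  case Nil
  then show ?case by simp
next
  case (Cons y ys)
  consider "x < y" | "x = y" | "y < x" by linarith
  then show ?case
  proof cases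
    case 1
    then have "x \<notin> set ys" "filter (\<lambda>z. z < x) ys = []"
      using Cons.prems(1) by (auto simp: filter_empty_conv)
    then show ?thesis using 1 by simp
  next
    case 2
    then show ?thesis using alternating_dup[OF F, of u x ys] Cons.prems by simp
  next
    case 3
    let ?e = "if x \<in> set ys then 0 else t ^ length (filter (\<lambda>y. y < x) ys)"
    have "F (u @ x # y # ys) \<approx> sc t * F ((u @ [y]) @ x # ys)"
      using alternating_swap[OF F, of y x u ys] 3 Cons.prems(2) by simp
    also have "\<dots> \<approx> sc t * (sc ?e * F ((u @ [y]) @ insort x ys))"
      by (rule cong_sc, rule Cons.IH) (use Cons.prems in auto)
    finally show ?thesis
      using 3 by (auto simp: sc_sc)
  qed
qed

text \<open>Insertion sort: the tail is sorted first, and inserting the head then contributes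
  exactly the factor in the recursion of \<open>eps\<close>.\<close>

lemma alternating_sort:
  assumes F: "alternating S t F"
    and "set (u @ w) \<subseteq> S"
  shows "F (u @ w) \<approx> sc (eps t w) * F (u @ sort w)"
  using assms(2)
proof (induction w arbitrary: u)
  case Nil
  then show ?case by simp
next
  case (Cons x w)
  let ?e = "if x \<in> set w then 0 else t ^ length (filter (\<lambda>y. y < x) w)"
  \<comment> \<open>The factor from \<open>alternating_insort\<close> counts letters of the sorted
    tail, whereas \<open>eps\<close> counts letters of \<open>w\<close>.\<close>
  have len: "length (filter P (sort w)) = length (filter P w)" for P
    by (metis mset_filter mset_sort size_mset)
  have "F (u @ x # w) \<approx> sc (eps t w) * F (u @ x # sort w)"
    using Cons.IH[of "u @ [x]"] Cons.prems by simp
  also have "\<dots> \<approx> sc (eps t w) * (sc ?e * F (u @ insort x (sort w)))"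
    using alternating_insort[OF F, of "sort w" u x] Cons.prems
    by (intro cong_sc) (simp add: len split: if_splits)
  finally show ?case
    by (auto simp: sc_sc mult.commute)
qed

lemma alternating_top:
  assumes F: "alternating {1..m} t F"
    and w: "w \<in> words m {1..m}"
  shows "F w \<approx> sc (eps t w) * F [1..<m + 1]"
proof -
  have *: "F w \<approx> sc (eps t w) * F (sort w)"
    using alternating_sort[OF F, of "[]" w] w by (simp add: words_def)
  show ?thesis
  proof (cases "distinct w")
    case True
    then show ?thesis using * top_word[OF w] by simp
  next
    case False
    then show ?thesis using * by (simp add: eps_not_distinct)
  qed
qed

end

subsection \<open>Quantum matrices\<close>

text \<open>The defining relations are memberships in \<open>I\<close>, for an arbitrary array and
  arbitrary parameters, so that the transposed matrix is another instance.\<close>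

locale quantum_matrix = scalar_ideal +
  fixes a :: "nat \<Rightarrow> nat \<Rightarrow> 'a" and r s :: complex and N :: nat
  assumes r_nonzero: "r \<noteq> 0" and s_nonzero: "s \<noteq> 0"
    and I_left: "i \<in> {1..N} \<Longrightarrow> j \<in> {1..N} \<Longrightarrow> x \<in> I \<Longrightarrow> a i j * x \<in> I"
    and I_right: "i \<in> {1..N} \<Longrightarrow> j \<in> {1..N} \<Longrightarrow> x \<in> I \<Longrightarrow> x * a i j \<in> I"
    and row: "\<lbrakk>i \<in> {1..N}; k \<in> {1..N}; l \<in> {1..N}; k < l\<rbrakk> \<Longrightarrow>
      a i k * a i l - sc r * (a i l * a i k) \<in> I"
    and column: "\<lbrakk>i \<in> {1..N}; j \<in> {1..N}; k \<in> {1..N}; i < j\<rbrakk> \<Longrightarrow>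
      a i k * a j k - sc (inverse s) * (a j k * a i k) \<in> I"
    and anti: "\<lbrakk>i \<in> {1..N}; j \<in> {1..N}; k \<in> {1..N}; l \<in> {1..N}; i < j; k < l\<rbrakk> \<Longrightarrow>
      sc r * (a i l * a j k) - sc (inverse s) * (a j k * a i l) \<in> I"
    and cross: "\<lbrakk>i \<in> {1..N}; j \<in> {1..N}; k \<in> {1..N}; l \<in> {1..N}; i < j; k < l\<rbrakk> \<Longrightarrow>
      a i k * a j l - a j l * a i k - sc (r - s) * (a i l * a j k) \<in> I"
begin

abbreviation D :: "nat list \<Rightarrow> 'a" where
  "D \<equiv> row_det (- r) N a"

lemma I_minus: "x \<in> I \<Longrightarrow> - x \<in> I"
  using I_sc[of x "-1"] by (simp add: sc_minus)

lemma I_prod_list_left: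
  "set u \<subseteq> {1..N} \<Longrightarrow> set x \<subseteq> {1..N} \<Longrightarrow> z \<in> I \<Longrightarrow> prod_list (map2 a u x) * z \<in> I"
  by (induction u x rule: list_induct2') (auto simp: mult.assoc intro!: I_left)

lemma I_prod_list_right:
  "set u \<subseteq> {1..N} \<Longrightarrow> set x \<subseteq> {1..N} \<Longrightarrow> z \<in> I \<Longrightarrow> z * prod_list (map2 a u x) \<in> I"
proof (induction u x arbitrary: z rule: list_induct2')
  case (4 i u j x)
  have "(z * a i j) * prod_list (map2 a u x) \<in> I"
    using 4 by (intro "4.IH" I_right) auto
  then show ?case by (simp add: mult.assoc)
qed auto

text \<open>The coefficient of \<open>x\<^sub>k x\<^sub>l\<close> in the relation
  \<open>y\<^sub>j y\<^sub>i = - r y\<^sub>i y\<^sub>j\<close>.\<close>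

lemma minor_swap:
  assumes "i \<in> {1..N}" "j \<in> {1..N}" "k \<in> {1..N}" "l \<in> {1..N}" "i < j" "k < l"
  shows "(a j k * a i l + sc (- r) * (a j l * a i k)) -
    sc (- r) * (a i k * a j l + sc (- r) * (a i l * a j k)) \<in> I"
proof -
  define X Y Z W where defs: "X = a j k * a i l" "Y = a j l * a i k" "Z = a i k * a j l" "W = a i l * a j k"
  have inv: "sc s * (sc (inverse s) * x) = x" for x
    using s_nonzero by (simp add: sc_sc)
  have comm: "sc s * (sc r * x) = sc r * (sc s * x)" for x
    by (simp add: sc_sc mult.commute)
  \<comment> \<open>In \<open>r\<close> times \<open>cross\<close> minus \<open>s\<close> times
    \<open>anti\<close>, the two multiples of \<open>W\<close> by \<open>r * s\<close> cancel and
    leave the required coefficient \<open>- r\<^sup>2\<close>.\<close>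
  have "sc r * (Z - Y - sc (r - s) * W) + sc (- s) * (sc r * W - sc (inverse s) * X) \<in> I"
    using cross[OF assms] anti[OF assms] unfolding defs by (intro I_add I_sc)
  also have "sc r * (Z - Y - sc (r - s) * W) + sc (- s) * (sc r * W - sc (inverse s) * X) =
      (X + sc (- r) * Y) - sc (- r) * (Z + sc (- r) * W)"
    by (simp add: sc_minus sc_diff algebra_simps inv comm)
  finally show ?thesis unfolding defs .
qed

text \<open>The coefficient of \<open>x\<^sub>k x\<^sub>l\<close> in the relation
  \<open>y\<^sub>i\<^sup>2 = 0\<close>.\<close>

lemma minor_dup:
  assumes "i \<in> {1..N}" "k \<in> {1..N}" "l \<in> {1..N}" "k < l"
  shows "a i k * a i l + sc (- r) * (a i l * a i k) \<in> I"
  using row[OF assms] by (simp add: sc_minus)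

text \<open>After \<open>row_det_split\<close>, \<open>sum_antisym\<close> reduces the inner sum to
  2 by 2 minors, to which \<open>minor_swap\<close> and \<open>minor_dup\<close> apply;
  \<open>I\<close> absorbs the products of entries on both sides.\<close>

lemma alternating_row_det: "alternating {1..N} (- r) D"
  unfolding alternating_def
proof (intro conjI allI impI)
  fix u v :: "nat list" and i j :: nat
  assume ij: "i < j" and set: "set (u @ i # j # v) \<subseteq> {1..N}"
  let ?S = "{1..N}"
  have factor: "sc e * x - sc c * (sc e * y) = sc e * (x - sc c * y)" for e c x y
    by (simp add: right_diff_distrib sc_sc mult.commute)
  have sandwich: "p * x * q - sc c * (p * y * q) = p * (x - sc c * y) * q" for p x q y c
    by (simp add: right_diff_distrib left_diff_distrib sc_left_commute mult.assoc)
  let ?inner = "\<lambda>i j x y. \<Sum>k\<in>?S. \<Sum>l\<in>?S. sc (eps (- r) (x @ k # l # y)) * (a i k * a j l)"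
  have inner: "?inner j i x y - sc (- r) * ?inner i j x y \<in> I" for x y
  proof -
    have e: "?inner i j x y = (\<Sum>k\<in>?S. \<Sum>l\<in>?S. if k < l then sc (eps (- r) (x @ k # l # y)) *
        (a i k * a j l + sc (- r) * (a i l * a j k)) else 0)" for i j
      by (intro sum_antisym eps_dup eps_swap)
    have "?inner j i x y - sc (- r) * ?inner i j x y = (\<Sum>k\<in>?S. \<Sum>l\<in>?S.
        if k < l then sc (eps (- r) (x @ k # l # y)) * ((a j k * a i l + sc (- r) * (a j l * a i k)) -
          sc (- r) * (a i k * a j l + sc (- r) * (a i l * a j k))) else 0)"
      unfolding e sum_distrib_left sum_subtractf[symmetric]
      by (intro sum.cong refl) (simp add: factor)
    also have "\<dots> \<in> I"
    proof (intro I_sum)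
      fix k l assume "k \<in> ?S" "l \<in> ?S"
      then show "(if k < l then sc (eps (- r) (x @ k # l # y)) *
          ((a j k * a i l + sc (- r) * (a j l * a i k)) -
          sc (- r) * (a i k * a j l + sc (- r) * (a i l * a j k))) else 0) \<in> I"
        using minor_swap[of i j k l] ij set by (simp add: I_0 I_sc)
    qed
    finally show ?thesis .
  qed
  have "D (u @ j # i # v) - sc (- r) * D (u @ i # j # v) =
      (\<Sum>x\<in>words (length u) ?S. \<Sum>y\<in>words (length v) ?S. prod_list (map2 a u x) *
        (?inner j i x y - sc (- r) * ?inner i j x y) * prod_list (map2 a v y))"
    unfolding row_det_split sandwich[symmetric] sum_subtractf
      sum_distrib_left[where r = "sc (- r)", symmetric] ..
  also have "\<dots> \<in> I"
    using set by (intro I_sum I_prod_list_left I_prod_list_right inner) (auto simp: words_def)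
  finally show "D (u @ j # i # v) \<approx> sc (- r) * D (u @ i # j # v)"
    by (simp add: cong_def)
next
  fix u v :: "nat list" and i :: nat
  assume set: "set (u @ i # i # v) \<subseteq> {1..N}"
  let ?S = "{1..N}"
  let ?inner = "\<lambda>x y. \<Sum>k\<in>?S. \<Sum>l\<in>?S. sc (eps (- r) (x @ k # l # y)) * (a i k * a i l)"
  have inner: "?inner x y \<in> I" for x y
  proof -
    have "?inner x y = (\<Sum>k\<in>?S. \<Sum>l\<in>?S. if k < l then sc (eps (- r) (x @ k # l # y)) *
        (a i k * a i l + sc (- r) * (a i l * a i k)) else 0)"
      by (intro sum_antisym eps_dup eps_swap)
    also have "\<dots> \<in> I"
    proof (intro I_sum)
      fix k l assume "k \<in> ?S" "l \<in> ?S"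
      then show "(if k < l then sc (eps (- r) (x @ k # l # y)) *
          (a i k * a i l + sc (- r) * (a i l * a i k)) else 0) \<in> I"
        using minor_dup[of i k l] set by (simp add: I_0 I_sc)
    qed
    finally show ?thesis .
  qed
  have "D (u @ i # i # v) \<in> I"
    unfolding row_det_split
    using set by (intro I_sum I_prod_list_left I_prod_list_right inner) (auto simp: words_def)
  then show "D (u @ i # i # v) \<approx> 0"
    by (simp add: cong_def)
qed

lemma row_det_cong: "w \<in> words N {1..N} \<Longrightarrow> D w \<approx> sc (eps (- r) w) * D [1..<N + 1]"
  by (rule alternating_top[OF alternating_row_det])

text \<open>Moving one block of two rows past another takes four adjacent swaps, each with factor
  \<open>- r\<close>. If a block repeats, a single swap brings two equal rows together.\<close>

lemma alternating_row_det_pairs: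
  assumes N: "N = 2 * n"
  shows "alternating {1..n} (r ^ 4) (\<lambda>ms. D (concat (map (\<lambda>m. [2 * m - 1, 2 * m]) ms)))"
  unfolding alternating_def
proof (intro conjI allI impI)
  let ?rows = "\<lambda>ms. concat (map (\<lambda>m. [2 * m - 1, 2 * m]) ms)"
  have rows: "set (?rows ms) \<subseteq> {1..N}" if "set ms \<subseteq> {1..n}" for ms
    using that N by fastforce
  note swap = alternating_swap[OF alternating_row_det]
  {
    fix u v i j
    assume ij: "i < j" and set: "set (u @ i # j # v) \<subseteq> {1..n}"
    define p q p' q' where defs: "p = 2 * i - 1" "q = 2 * i" "p' = 2 * j - 1" "q' = 2 * j"
    have lt: "p < p'" "p < q'" "q < p'" "q < q'"
      using ij set by (auto simp: defs)
    have in_N: "set (?rows u @ [p, q, p', q'] @ ?rows v) \<subseteq> {1..N}"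
      using rows[OF set] by (simp add: defs)
    have "D (?rows u @ [p', q', p, q] @ ?rows v) \<approx> sc (- r) * D (?rows u @ [p', p, q', q] @ ?rows v)"
      using swap[of p q' "?rows u @ [p']" "q # ?rows v"] lt in_N by simp
    also have "\<dots> \<approx> sc (- r) * (sc (- r) * D (?rows u @ [p, p', q', q] @ ?rows v))"
      using swap[of p p' "?rows u" "q' # q # ?rows v"] lt in_N by (intro cong_sc) simp
    also have "\<dots> \<approx> sc (- r) * (sc (- r) * (sc (- r) * D (?rows u @ [p, p', q, q'] @ ?rows v)))"
      using swap[of q q' "?rows u @ [p, p']" "?rows v"] lt in_N by (intro cong_sc) simp
    also have "\<dots> \<approx> sc (- r) * (sc (- r) * (sc (- r) * (sc (- r) * D (?rows u @ [p, q, p', q'] @ ?rows v))))"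
      using swap[of q p' "?rows u @ [p]" "q' # ?rows v"] lt in_N by (intro cong_sc) simp
    finally show "D (?rows (u @ j # i # v)) \<approx> sc (r ^ 4) * D (?rows (u @ i # j # v))"
      by (simp add: sc_sc defs power4_eq_xxxx mult.assoc)
  next
    fix u v i
    assume set: "set (u @ i # i # v) \<subseteq> {1..n}"
    define p q where defs: "p = 2 * i - 1" "q = 2 * i"
    have "p < q" using set by (auto simp: defs)
    have in_N: "set (?rows u @ [p, q, p, q] @ ?rows v) \<subseteq> {1..N}"
      using rows[OF set] by (simp add: defs)
    have "D (?rows u @ [p, q, p, q] @ ?rows v) \<approx> sc (- r) * D (?rows u @ [p, p, q, q] @ ?rows v)"
      using swap[of p q "?rows u @ [p]" "q # ?rows v"] \<open>p < q\<close> in_N by simp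
    also have "\<dots> \<approx> sc (- r) * 0"
      using alternating_dup[OF alternating_row_det, of "?rows u" p "q # q # ?rows v"] in_N
      by (intro cong_sc) simp
    finally show "D (?rows (u @ i # i # v)) \<approx> 0"
      by (simp add: defs)
  }
qed

lemma pf_sum_cong:
  assumes N: "N = 2 * n"
  shows "pf_sum r n (\<lambda>k l. \<Sum>m\<in>{1..n}.
      a (2 * m - 1) k * a (2 * m) l - sc r * (a (2 * m - 1) l * a (2 * m) k)) \<approx>
    sc (qfact (r ^ 4) n) * D [1..<N + 1]"
proof -
  let ?rows = "\<lambda>ms. concat (map (\<lambda>m. [2 * m - 1, 2 * m]) ms)"
  \<comment> \<open>Blocks in increasing order list the rows in increasing order, so the reference
    value is the full determinant.\<close>
  have top: "?rows [1..<n + 1] = [1..<N + 1]"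
    using map_pairs_upt[of "\<lambda>x. x" n] N by simp
  have "(\<Sum>ms\<in>words n {1..n}. D (?rows ms)) \<approx>
      (\<Sum>ms\<in>words n {1..n}. sc (eps (r ^ 4) ms) * D (?rows [1..<n + 1]))"
    by (intro cong_sum alternating_top[OF alternating_row_det_pairs] N)
  also have "\<dots> = sc (\<Sum>ms\<in>words n {1..n}. eps (r ^ 4) ms) * D [1..<N + 1]"
    unfolding top sc_sum sum_distrib_right ..
  also have "\<dots> = sc (qfact (r ^ 4) n) * D [1..<N + 1]"
    using sum_eps[of "{1..n}" "r ^ 4"] by simp
  finally show ?thesis
    unfolding N sum_row_det_pairs .
qed

lemma pf_cong:
  assumes "N = 2 * n" "\<not> root_of_unity r"
  shows "sc (1 / qfact (r ^ 4) n) * pf_sum r n (\<lambda>k l. \<Sum>m\<in>{1..n}.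
      a (2 * m - 1) k * a (2 * m) l - sc r * (a (2 * m - 1) l * a (2 * m) k)) \<approx> D [1..<N + 1]"
proof -
  have "\<not> root_of_unity (r ^ 4)"
    using assms(2) unfolding root_of_unity_def
    by (metis power_mult zero_less_mult_iff nat_0_less_mult_iff zero_less_numeral)
  then show ?thesis
    using cong_sc[OF pf_sum_cong[OF assms(1)], of "1 / qfact (r ^ 4) n"]
    by (simp add: sc_sc qfact_nonzero)
qed

text \<open>Transposition exchanges the row relation with the column relation, which forces the new
  parameters; only the last relation requires a combination of two old ones.\<close>

lemma transpose: "quantum_matrix sc I (\<lambda>i j. a j i) (inverse s) (inverse r) N"
proof unfold_locales
  show "a k i * a l i - sc (inverse s) * (a l i * a k i) \<in> I"
    if "i \<in> {1..N}" "k \<in> {1..N}" "l \<in> {1..N}" "k < l" for i k l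
    using column[of k l i] that by simp
  show "a k i * a k j - sc (inverse (inverse r)) * (a k j * a k i) \<in> I"
    if "i \<in> {1..N}" "j \<in> {1..N}" "k \<in> {1..N}" "i < j" for i j k
    using row[of k i j] that by simp
  show "sc (inverse s) * (a l i * a k j) - sc (inverse (inverse r)) * (a k j * a l i) \<in> I"
    if "i \<in> {1..N}" "j \<in> {1..N}" "k \<in> {1..N}" "l \<in> {1..N}" "i < j" "k < l" for i j k l
    using I_minus[OF anti[of k l i j]] that by simp
  show "a k i * a l j - a l j * a k i - sc (inverse s - inverse r) * (a l i * a k j) \<in> I"
    if "i \<in> {1..N}" "j \<in> {1..N}" "k \<in> {1..N}" "l \<in> {1..N}" "i < j" "k < l" for i j k l
  proof -
    have c: "(r - s) / r * r = r - s" "(r - s) / r * inverse s = inverse s - inverse r"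
      using r_nonzero s_nonzero by (simp_all add: field_simps)
    \<comment> \<open>The multiple of \<open>anti\<close> is chosen to cancel the product
      \<open>a k j * a l i\<close> from \<open>cross\<close>, leaving its reverse with coefficient
      \<open>inverse s - inverse r\<close>.\<close>
    have "(a k i * a l j - a l j * a k i - sc (r - s) * (a k j * a l i)) +
        sc ((r - s) / r) * (sc r * (a k j * a l i) - sc (inverse s) * (a l i * a k j)) \<in> I"
      using that by (intro I_add I_sc cross anti)
    also have "(a k i * a l j - a l j * a k i - sc (r - s) * (a k j * a l i)) +
        sc ((r - s) / r) * (sc r * (a k j * a l i) - sc (inverse s) * (a l i * a k j)) =
        a k i * a l j - a l j * a k i - sc (inverse s - inverse r) * (a l i * a k j)"
      unfolding right_diff_distrib sc_sc c by simp
    finally show ?thesis .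
  qed
qed (use r_nonzero s_nonzero I_left I_right in auto)

text \<open>
  The double sum over words of \<open>eps (- r) js * eps (- inverse s) is * a is js\<close> is a
  \<open>qfact\<close> multiple of both determinants, by summing over the rows first or over the columns first.
\<close>

lemma row_det_transpose:
  assumes "\<not> root_of_unity (r / s)"
  shows "D [1..<N + 1] \<approx> row_det (- inverse s) N (\<lambda>i j. a j i) [1..<N + 1]"
proof -
  interpret T: quantum_matrix sc I "\<lambda>i j. a j i" "inverse s" "inverse r" N
    by (rule transpose)
  let ?q = "qfact (r / s) N"
  have q: "(\<Sum>w\<in>words N {1..N}. eps (r / s) w) = ?q"
    using sum_eps[of "{1..N}" "r / s"] by simp
  have sum_eps_mult: "(\<Sum>w\<in>words N {1..N}. sc (eps t w) * (sc (eps t' w) * d)) = sc ?q * d"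
    if "t * t' = r / s" for t t' d
    unfolding sc_sc eps_mult that q[symmetric] sc_sum sum_distrib_right ..
  have "sc ?q * D [1..<N + 1] =
      (\<Sum>w\<in>words N {1..N}. sc (eps (- inverse s) w) * (sc (eps (- r) w) * D [1..<N + 1]))"
    by (rule sum_eps_mult[symmetric]) (simp add: divide_inverse)
  also have "\<dots> \<approx> (\<Sum>w\<in>words N {1..N}. sc (eps (- inverse s) w) * D w)"
    by (intro cong_sum cong_sc cong_sym[OF row_det_cong])
  also have "\<dots> = (\<Sum>w\<in>words N {1..N}. sc (eps (- r) w) * T.D w)"
    by (rule sum_row_det_transpose)
  also have "\<dots> \<approx>
      (\<Sum>w\<in>words N {1..N}. sc (eps (- r) w) * (sc (eps (- inverse s) w) * T.D [1..<N + 1]))"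
    by (intro cong_sum cong_sc T.row_det_cong)
  also have "\<dots> = sc ?q * T.D [1..<N + 1]"
    by (rule sum_eps_mult) (simp add: divide_inverse)
  finally have "sc ?q * D [1..<N + 1] \<approx> sc ?q * T.D [1..<N + 1]" .
  \<comment> \<open>The quantum factorial can be cancelled because \<open>r / s\<close> is not a
    root of unity.\<close>
  from cong_sc[OF this, of "inverse ?q"] show ?thesis
    by (simp add: sc_sc qfact_nonzero[OF assms])
qed

text \<open>The entries are minors of the matrix and of its transpose in the form produced by
  \<open>pf_cong\<close>. Their agreement modulo the ideal with the minors defining \<open>B\<close>
  and \<open>B'\<close> is left to the final theorem.\<close>

lemma pf_transpose:
  assumes "N = 2 * n" "\<not> root_of_unity r" "\<not> root_of_unity s" "\<not> root_of_unity (r / s)"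
  shows "sc (1 / qfact (r ^ 4) n) * pf_sum r n (\<lambda>k l. \<Sum>m\<in>{1..n}.
      a (2 * m - 1) k * a (2 * m) l - sc r * (a (2 * m - 1) l * a (2 * m) k)) \<approx>
    sc (1 / qfact (inverse s ^ 4) n) * pf_sum (inverse s) n (\<lambda>k l. \<Sum>m\<in>{1..n}.
      a k (2 * m - 1) * a l (2 * m) - sc (inverse s) * (a l (2 * m - 1) * a k (2 * m)))"
proof -
  interpret T: quantum_matrix sc I "\<lambda>i j. a j i" "inverse s" "inverse r" N
    by (rule transpose)
  have s: "\<not> root_of_unity (inverse s)"
    using assms(3) by (simp add: root_of_unity_def power_inverse)
  show ?thesis
    using cong_trans[OF pf_cong[OF assms(1,2)] cong_trans[OF row_det_transpose[OF assms(4)]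
        cong_sym[OF T.pf_cong[OF assms(1) s]]]] .
qed

end

subsection \<open>Passage to the quantum semigroup\<close>

lemma fscal_commute: "f * fscal c = fscal c * f"
proof (induction f rule: update_induct)
  case const
  then show ?case by simp
next
  case (update f k v)
  have "Poly_Mapping.update k v f = f + Poly_Mapping.single k v"
    using update.hyps(1)
    by (intro poly_mapping_eqI)
      (auto simp: lookup_update lookup_add lookup_single when_def in_keys_iff)
  then show ?case
    using update.IH by (simp add: distrib_left distrib_right fscal_def mult_single mult.commute)
qed

interpretation falg: central_scalars fscal
proof
  show "fscal (c + d) = fscal c + fscal d" for c d
    by (simp add: fscal_def single_add)
  show "fscal (c * d) = fscal c * fscal d" for c d
    by (simp add: fscal_def mult_single)
  show "fscal 1 = 1"
    by (simp add: fscal_def)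
  show "f * fscal c = fscal c * f" for f c
    by (rule fscal_commute)
qed

section \<open>Closure properties of the free algebra on a set of letters\<close>

lemma free_algebra_add_closed:
  "f \<in> carrier (free_algebra X) \<Longrightarrow> g \<in> carrier (free_algebra X) \<Longrightarrow> f + g \<in> carrier (free_algebra X)"
  using Poly_Mapping.keys_add[of f g] by (force simp: free_algebra_def)

lemma free_algebra_mult_closed:
  "f \<in> carrier (free_algebra X) \<Longrightarrow> g \<in> carrier (free_algebra X) \<Longrightarrow> f * g \<in> carrier (free_algebra X)"
  using keys_mult[of f g] by (force simp: free_algebra_def plus_fmon_def)

lemma free_algebra_diff_closed:
  "f \<in> carrier (free_algebra X) \<Longrightarrow> g \<in> carrier (free_algebra X) \<Longrightarrow> f - g \<in> carrier (free_algebra X)"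
  using Poly_Mapping.keys_diff[of f g] by (force simp: free_algebra_def)

lemma free_algebra_sum_closed:
  "(\<And>x. x \<in> A \<Longrightarrow> f x \<in> carrier (free_algebra X)) \<Longrightarrow> sum f A \<in> carrier (free_algebra X)"
proof (induction A rule: infinite_finite_induct)
  case (insert x A)
  then show ?case by (simp add: free_algebra_add_closed)
qed (simp_all add: free_algebra_def)

lemma free_algebra_prod_list_closed:
  "set xs \<subseteq> carrier (free_algebra X) \<Longrightarrow> prod_list xs \<in> carrier (free_algebra X)"
proof (induction xs)
  case Nil
  then show ?case by (simp add: free_algebra_def zero_fmon_def)
next
  case (Cons x xs)
  then show ?case by (simp add: free_algebra_mult_closed)
qed

lemmas free_algebra_closed =
  free_algebra_add_closed free_algebra_mult_closed free_algebra_diff_closed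
  free_algebra_sum_closed free_algebra_prod_list_closed fscal_carrier

lemma qsemigroup_ideal_quantum_matrix:
  assumes "r \<noteq> 0" "s \<noteq> 0"
  shows "quantum_matrix fscal (qsemigroup_ideal r s N) (\<lambda>i j. fgen (i, j)) r s N"
proof -
  let ?F = "free_algebra ({1..N} \<times> {1..N})"
  interpret I: ideal "qsemigroup_ideal r s N" ?F
    by (rule qsemigroup_ideal)
  have rels: "x \<in> qsemigroup_ideal r s N" if "x \<in> qsemigroup_rels r s N" for x
    unfolding qsemigroup_ideal_def
    using I.genideal_self[OF qsemigroup_rels_carrier] that by blast
  have gen: "fgen (i, j) \<in> carrier ?F" if "i \<in> {1..N}" "j \<in> {1..N}" for i j
    using that by (intro fgen_carrier) blast
  have l: "f * x \<in> qsemigroup_ideal r s N"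
    if "f \<in> carrier ?F" "x \<in> qsemigroup_ideal r s N" for f x
    using I.I_l_closed[OF that(2,1)] by (simp add: free_algebra_def)
  have r: "x * f \<in> qsemigroup_ideal r s N"
    if "f \<in> carrier ?F" "x \<in> qsemigroup_ideal r s N" for f x
    using I.I_r_closed[OF that(2,1)] by (simp add: free_algebra_def)
  show ?thesis
  proof unfold_locales
    show "0 \<in> qsemigroup_ideal r s N"
      using additive_subgroup.zero_closed[OF I.additive_subgroup_axioms] by (simp add: free_algebra_def)
    show "x + y \<in> qsemigroup_ideal r s N"
      if "x \<in> qsemigroup_ideal r s N" "y \<in> qsemigroup_ideal r s N" for x y
      using additive_subgroup.a_closed[OF I.additive_subgroup_axioms that] by (simp add: free_algebra_def)
    show "fscal c * x \<in> qsemigroup_ideal r s N" if "x \<in> qsemigroup_ideal r s N" for c x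
      by (rule l[OF fscal_carrier that])
    show "fgen (i, j) * x \<in> qsemigroup_ideal r s N"
      if "i \<in> {1..N}" "j \<in> {1..N}" "x \<in> qsemigroup_ideal r s N" for i j x
      by (rule l[OF gen[OF that(1,2)] that(3)])
    show "x * fgen (i, j) \<in> qsemigroup_ideal r s N"
      if "i \<in> {1..N}" "j \<in> {1..N}" "x \<in> qsemigroup_ideal r s N" for i j x
      by (rule r[OF gen[OF that(1,2)] that(3)])
    show "fgen (i, k) * fgen (i, l) - fscal r * (fgen (i, l) * fgen (i, k)) \<in> qsemigroup_ideal r s N"
      if "i \<in> {1..N}" "k \<in> {1..N}" "l \<in> {1..N}" "k < l" for i k l
      \<comment> \<open>The generators of the ideal bracket a scalar with the first letter, so
        products are regrouped to the left to match them.\<close>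
      using that unfolding mult.assoc[symmetric]
      by (intro rels, unfold qsemigroup_rels_def Let_def) blast
    show "fgen (i, k) * fgen (j, k) - fscal (inverse s) * (fgen (j, k) * fgen (i, k))
        \<in> qsemigroup_ideal r s N"
      if "i \<in> {1..N}" "j \<in> {1..N}" "k \<in> {1..N}" "i < j" for i j k
      using that unfolding mult.assoc[symmetric]
      by (intro rels, unfold qsemigroup_rels_def Let_def) blast
    show "fscal r * (fgen (i, l) * fgen (j, k)) - fscal (inverse s) * (fgen (j, k) * fgen (i, l))
        \<in> qsemigroup_ideal r s N"
      if "i \<in> {1..N}" "j \<in> {1..N}" "k \<in> {1..N}" "l \<in> {1..N}" "i < j" "k < l" for i j k l
      using that unfolding mult.assoc[symmetric]
      by (intro rels, unfold qsemigroup_rels_def Let_def) blast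
    show "fgen (i, k) * fgen (j, l) - fgen (j, l) * fgen (i, k) -
        fscal (r - s) * (fgen (i, l) * fgen (j, k)) \<in> qsemigroup_ideal r s N"
      if "i \<in> {1..N}" "j \<in> {1..N}" "k \<in> {1..N}" "l \<in> {1..N}" "i < j" "k < l" for i j k l
      using that unfolding mult.assoc[symmetric]
      by (intro rels, unfold qsemigroup_rels_def Let_def) blast
  qed (use assms in simp_all)
qed

section \<open>The class map as a homomorphism of complex algebras\<close>

lemma qclass_closed:
  "f \<in> carrier (free_algebra ({1..N} \<times> {1..N})) \<Longrightarrow>
    qclass r s N f \<in> carrier (qsemigroup r s N)"
  unfolding qclass_def qsemigroup_simps
  by (rule ring_hom_closed[OF ideal.rcos_ring_hom[OF qsemigroup_ideal]])

lemma qclass_add: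
  assumes "f \<in> carrier (free_algebra ({1..N} \<times> {1..N}))" "g \<in> carrier (free_algebra ({1..N} \<times> {1..N}))"
  shows "qclass r s N (f + g) = qclass r s N f \<oplus>\<^bsub>qsemigroup r s N\<^esub> qclass r s N g"
  using ring_hom_add[OF ideal.rcos_ring_hom[OF qsemigroup_ideal] assms]
  unfolding qclass_def qsemigroup_simps by (simp add: free_algebra_def)

lemma qclass_mult:
  assumes "f \<in> carrier (free_algebra ({1..N} \<times> {1..N}))" "g \<in> carrier (free_algebra ({1..N} \<times> {1..N}))"
  shows "qclass r s N (f * g) = qclass r s N f \<otimes>\<^bsub>qsemigroup r s N\<^esub> qclass r s N g"
  using ring_hom_mult[OF ideal.rcos_ring_hom[OF qsemigroup_ideal] assms]
  unfolding qclass_def qsemigroup_simps by (simp add: free_algebra_def)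

lemma qclass_one: "qclass r s N 1 = \<one>\<^bsub>qsemigroup r s N\<^esub>"
  using ring_hom_one[OF ideal.rcos_ring_hom[OF qsemigroup_ideal]]
  unfolding qclass_def qsemigroup_simps by (simp add: free_algebra_def)

lemma qclass_smult:
  "f \<in> carrier (free_algebra ({1..N} \<times> {1..N})) \<Longrightarrow>
    qclass r s N (fscal c * f) = c \<odot>\<^bsub>qsemigroup r s N\<^esub> qclass r s N f"
  using qclass_mult[OF fscal_carrier] by (simp add: qsemigroup_simps)

lemma qclass_zero: "qclass r s N 0 = \<zero>\<^bsub>qsemigroup r s N\<^esub>"
proof -
  interpret Q: ring "qsemigroup r s N" by (rule qsemigroup_ring)
  have z: "0 \<in> carrier (free_algebra ({1..N} \<times> {1..N}))" by (simp add: free_algebra_def)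
  show ?thesis
    \<comment> \<open>From \<open>0 + 0 = 0\<close>, the class of 0 is its own double and hence
      zero.\<close>
    using qclass_add[OF z z, of r s] qclass_closed[OF z, of r s] Q.add.r_cancel_one'
    by (metis add_0)
qed

lemma qclass_sum:
  assumes "finite A" "\<And>x. x \<in> A \<Longrightarrow> f x \<in> carrier (free_algebra ({1..N} \<times> {1..N}))"
  shows "qclass r s N (sum f A) = (\<Oplus>\<^bsub>qsemigroup r s N\<^esub>x\<in>A. qclass r s N (f x))"
proof -
  interpret Q: ring "qsemigroup r s N" by (rule qsemigroup_ring)
  show ?thesis
    using assms
  proof (induction A rule: finite_induct)
    case empty
    then show ?case by (simp add: qclass_zero)
  next
    case (insert x A)
    then show ?case
      by (simp add: qclass_add qclass_closed free_algebra_sum_closed Q.finsum_insert Pi_iff)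
  qed
qed

lemma qclass_prod_list:
  "set xs \<subseteq> carrier (free_algebra ({1..N} \<times> {1..N})) \<Longrightarrow>
    qclass r s N (prod_list xs) = lprod (qsemigroup r s N) (map (qclass r s N) xs)"
  by (induction xs)
    (simp_all add: lprod_def qclass_one qclass_mult free_algebra_prod_list_closed)

lemma qclass_eqI:
  assumes "f - g \<in> qsemigroup_ideal r s N"
    and "f \<in> carrier (free_algebra ({1..N} \<times> {1..N}))" "g \<in> carrier (free_algebra ({1..N} \<times> {1..N}))"
  shows "qclass r s N f = qclass r s N g"
proof -
  interpret I: ideal "qsemigroup_ideal r s N" "free_algebra ({1..N} \<times> {1..N})"
    by (rule qsemigroup_ideal)
  interpret Q: ring "qsemigroup r s N" by (rule qsemigroup_ring)
  have "qclass r s N (f - g) = \<zero>\<^bsub>qsemigroup r s N\<^esub>"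
    unfolding qclass_def qsemigroup_simps using I.a_rcos_const[OF assms(1)] by (simp add: FactRing_def)
  moreover have "qclass r s N f = qclass r s N (f - g) \<oplus>\<^bsub>qsemigroup r s N\<^esub> qclass r s N g"
    using qclass_add[OF free_algebra_diff_closed[OF assms(2,3)] assms(3)] by simp
  ultimately show ?thesis
    using qclass_closed[OF assms(3)] by simp
qed

lemma fgen_closed:
  "i \<in> {1..N} \<Longrightarrow> j \<in> {1..N} \<Longrightarrow> fgen (i, j) \<in> carrier (free_algebra ({1..N} \<times> {1..N}))"
  by (intro fgen_carrier) blast

section \<open>Explicit representatives of 2 by 2 quantum minors\<close>

lemma sum_permutes_2:
  fixes f :: "(nat \<Rightarrow> nat) \<Rightarrow> 'b::comm_monoid_add"
  shows "sum f {\<sigma>. \<sigma> permutes {..<2}} = f id + f (Transposition.transpose 0 1)"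
proof -
  have "{..<2} = {0, 1::nat}" by auto
  then have "{\<sigma>. \<sigma> permutes {..<2}} = {id, Transposition.transpose 0 (1::nat)}"
    by (auto simp: permutes_doubleton_iff)
  moreover have "id \<noteq> Transposition.transpose 0 (1::nat)"
    by (metis id_apply transpose_apply_first zero_neq_one)
  ultimately show ?thesis by simp
qed

lemma inv_count_2:
  "inv_count {..<2} id = 0" "inv_count {..<2} (Transposition.transpose 0 1) = 1"
proof -
  have "{(i, j). i \<in> {..<2} \<and> j \<in> {..<2} \<and> i < j \<and>
      Transposition.transpose 0 1 j < Transposition.transpose 0 1 (i::nat)} = {(0, 1::nat)}"
    by (auto simp: Transposition.transpose_def split: if_splits)
  then show "inv_count {..<2} (Transposition.transpose 0 1) = 1"
    by (simp add: inv_count_def)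
  have "{(i, j). i \<in> {..<2} \<and> j \<in> {..<2::nat} \<and> i < j \<and> id j < id i} = {}"
    by auto
  then show "inv_count {..<2} id = 0"
    by (simp only: inv_count_def card.empty)
qed

text \<open>Common to row and column minors: \<open>f\<close> lists the two generators selected by a
  permutation of the positions 0 and 1.\<close>

lemma finsum_permutes_2:
  assumes "\<And>\<sigma>. \<sigma> permutes {..<2} \<Longrightarrow> set (f \<sigma>) \<subseteq> carrier (free_algebra ({1..N} \<times> {1..N}))"
  shows "(\<Oplus>\<^bsub>qsemigroup r s N\<^esub>\<sigma>\<in>{\<sigma>. \<sigma> permutes {..<2}}.
      ((- q) ^ inv_count {..<2} \<sigma>) \<odot>\<^bsub>qsemigroup r s N\<^esub>
        lprod (qsemigroup r s N) (map (qclass r s N) (f \<sigma>))) =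
    qclass r s N (prod_list (f id) - fscal q * prod_list (f (Transposition.transpose 0 1)))"
proof -
  interpret Q: ring "qsemigroup r s N" by (rule qsemigroup_ring)
  let ?P = "{\<sigma>. \<sigma> permutes {..<2::nat}}"
  let ?g = "\<lambda>\<sigma>. fscal ((- q) ^ inv_count {..<2} \<sigma>) * prod_list (f \<sigma>)"
  have closed: "?g \<sigma> \<in> carrier (free_algebra ({1..N} \<times> {1..N}))" if "\<sigma> \<in> ?P" for \<sigma>
    using that assms by (intro free_algebra_closed) simp
  have "(\<Oplus>\<^bsub>qsemigroup r s N\<^esub>\<sigma>\<in>?P. ((- q) ^ inv_count {..<2} \<sigma>) \<odot>\<^bsub>qsemigroup r s N\<^esub>
        lprod (qsemigroup r s N) (map (qclass r s N) (f \<sigma>))) =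
      (\<Oplus>\<^bsub>qsemigroup r s N\<^esub>\<sigma>\<in>?P. qclass r s N (?g \<sigma>))"
  proof (rule Q.finsum_cong')
    fix \<sigma> assume "\<sigma> \<in> ?P"
    then have l: "set (f \<sigma>) \<subseteq> carrier (free_algebra ({1..N} \<times> {1..N}))"
      using assms by simp
    show "((- q) ^ inv_count {..<2} \<sigma>) \<odot>\<^bsub>qsemigroup r s N\<^esub>
        lprod (qsemigroup r s N) (map (qclass r s N) (f \<sigma>)) = qclass r s N (?g \<sigma>)"
      by (simp only: qclass_smult[OF free_algebra_prod_list_closed[OF l]] qclass_prod_list[OF l])
  qed (auto intro!: qclass_closed closed simp del: One_nat_def)
  also have "\<dots> = qclass r s N (sum ?g ?P)"
    using closed by (intro qclass_sum[symmetric] finite_permutations) simp_all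
  also have "sum ?g ?P = prod_list (f id) - fscal q * prod_list (f (Transposition.transpose 0 1))"
    unfolding sum_permutes_2 inv_count_2 by (simp add: falg.sc_minus)
  finally show ?thesis .
qed

lemma minor_closed:
  assumes "i \<in> {1..N}" "j \<in> {1..N}" "k \<in> {1..N}" "l \<in> {1..N}"
    and "i' \<in> {1..N}" "j' \<in> {1..N}" "k' \<in> {1..N}" "l' \<in> {1..N}"
  shows "fgen (i, k) * fgen (j, l) - fscal q * (fgen (i', k') * fgen (j', l'))
    \<in> carrier (free_algebra ({1..N} \<times> {1..N}))"
  by (intro free_algebra_closed fgen_closed assms)

lemma permutes_2_cases:
  assumes "\<sigma> permutes {..<2}"
  shows "\<sigma> 0 \<in> {0, 1::nat}" "\<sigma> 1 \<in> {0, 1::nat}"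
  using permutes_in_image[OF assms, of 0] permutes_in_image[OF assms, of 1] by auto

lemma rdet_2:
  assumes "i \<in> {1..N}" "j \<in> {1..N}" "k \<in> {1..N}" "l \<in> {1..N}"
  shows "rdet (qsemigroup r s N) q (qgen r s N) [i, j] [k, l] =
    qclass r s N (fgen (i, k) * fgen (j, l) - fscal q * (fgen (i, l) * fgen (j, k)))"
proof -
  let ?f = "\<lambda>\<sigma>. [fgen (i, [k, l] ! \<sigma> 0), fgen (j, [k, l] ! \<sigma> 1)]"
  have "set (?f \<sigma>) \<subseteq> carrier (free_algebra ({1..N} \<times> {1..N}))" if "\<sigma> permutes {..<2}" for \<sigma>
    using permutes_2_cases[OF that] assms by (auto intro!: fgen_closed simp del: One_nat_def)
  from finsum_permutes_2[of ?f, OF this] show ?thesis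
    by (simp add: rdet_def qgen_def upt_conv_Cons numeral_2_eq_2)
qed

lemma cdet_2:
  assumes "i \<in> {1..N}" "j \<in> {1..N}" "k \<in> {1..N}" "l \<in> {1..N}"
  shows "cdet (qsemigroup r s N) q (qgen r s N) [i, j] [k, l] =
    qclass r s N (fgen (i, k) * fgen (j, l) - fscal q * (fgen (j, k) * fgen (i, l)))"
proof -
  let ?f = "\<lambda>\<sigma>. [fgen ([i, j] ! \<sigma> 0, k), fgen ([i, j] ! \<sigma> 1, l)]"
  have "set (?f \<sigma>) \<subseteq> carrier (free_algebra ({1..N} \<times> {1..N}))" if "\<sigma> permutes {..<2}" for \<sigma>
    using permutes_2_cases[OF that] assms by (auto intro!: fgen_closed simp del: One_nat_def)
  from finsum_permutes_2[of ?f, OF this] show ?thesis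
    by (simp add: cdet_def qgen_def upt_conv_Cons numeral_2_eq_2)
qed

section \<open>Pfaffians of arrays of classes\<close>

lemma pf_perms_bounds:
  assumes "\<sigma> \<in> pf_perms n" "k \<in> {1..n}"
  shows "1 \<le> \<sigma> (2 * k - 1)" "\<sigma> (2 * k - 1) < \<sigma> (2 * k)" "\<sigma> (2 * k) \<le> 2 * n"
proof -
  have \<sigma>: "\<sigma> permutes {1..2 * n}"
    using assms(1) by (simp add: pf_perms_def)
  have "\<sigma> i \<in> {1..2 * n}" if "i \<in> {1..2 * n}" for i
    using \<sigma> that by (simp only: permutes_in_image)
  moreover have "2 * k - 1 \<in> {1..2 * n}" "2 * k \<in> {1..2 * n}"
    using assms(2) by auto
  ultimately show "1 \<le> \<sigma> (2 * k - 1)" "\<sigma> (2 * k) \<le> 2 * n"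
    by (meson atLeastAtMost_iff)+
  show "\<sigma> (2 * k - 1) < \<sigma> (2 * k)"
    using assms by (simp add: pf_perms_def)
qed

lemma finite_pf_perms: "finite (pf_perms n)"
  by (rule finite_subset[OF _ finite_permutations[of "{1..2 * n}"]]) (auto simp: pf_perms_def)

lemma pf_list_closed:
  assumes "\<And>i j. 1 \<le> i \<Longrightarrow> i < j \<Longrightarrow> j \<le> 2 * n \<Longrightarrow> b i j \<in> carrier (free_algebra X)"
    and "\<sigma> \<in> pf_perms n"
  shows "set (map (\<lambda>k. b (\<sigma> (2 * k - 1)) (\<sigma> (2 * k))) [1..<n + 1]) \<subseteq> carrier (free_algebra X)"
  unfolding set_map
proof (rule image_subsetI)
  fix k assume "k \<in> set [1..<n + 1]"
  then have "k \<in> {1..n}" by auto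
  then show "b (\<sigma> (2 * k - 1)) (\<sigma> (2 * k)) \<in> carrier (free_algebra X)"
    by (intro assms(1) pf_perms_bounds[OF assms(2)])
qed

lemma pf_sum_closed:
  assumes "\<And>i j. 1 \<le> i \<Longrightarrow> i < j \<Longrightarrow> j \<le> 2 * n \<Longrightarrow> b i j \<in> carrier (free_algebra X)"
  shows "falg.pf_sum v n b \<in> carrier (free_algebra X)"
  unfolding falg.pf_sum_def by (intro free_algebra_closed pf_list_closed assms)

text \<open>Carries the Pfaffian back to representatives. By \<open>pf_perms_bounds\<close> it reads
  only entries with increasing indices in range, so information on those suffices.\<close>

lemma qpf_qclass:
  assumes b: "\<And>i j. 1 \<le> i \<Longrightarrow> i < j \<Longrightarrow> j \<le> 2 * n \<Longrightarrow>
      b i j \<in> carrier (free_algebra ({1..N} \<times> {1..N}))"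
    and B: "\<And>i j. 1 \<le> i \<Longrightarrow> i < j \<Longrightarrow> j \<le> 2 * n \<Longrightarrow> B i j = qclass r s N (b i j)"
  shows "qpf (qsemigroup r s N) v n B =
    qclass r s N (fscal (1 / qfact (v ^ 4) n) * falg.pf_sum v n b)"
proof -
  interpret Q: ring "qsemigroup r s N" by (rule qsemigroup_ring)
  let ?l = "\<lambda>\<sigma>. map (\<lambda>k. b (\<sigma> (2 * k - 1)) (\<sigma> (2 * k))) [1..<n + 1]"
  let ?L = "\<lambda>\<sigma>. map (\<lambda>k. B (\<sigma> (2 * k - 1)) (\<sigma> (2 * k))) [1..<n + 1]"
  let ?g = "\<lambda>\<sigma>. fscal ((- v) ^ inv_count {1..2 * n} \<sigma>) * prod_list (?l \<sigma>)"
  have closed: "?g \<sigma> \<in> carrier (free_algebra ({1..N} \<times> {1..N}))" if "\<sigma> \<in> pf_perms n" for \<sigma>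
    by (intro free_algebra_closed pf_list_closed b that)
  have L: "?L \<sigma> = map (qclass r s N) (?l \<sigma>)" if "\<sigma> \<in> pf_perms n" for \<sigma>
    unfolding map_map
  proof (rule map_cong[OF refl])
    fix k assume "k \<in> set [1..<n + 1]"
    then have "k \<in> {1..n}" by auto
    then show "B (\<sigma> (2 * k - 1)) (\<sigma> (2 * k)) =
        (qclass r s N \<circ> (\<lambda>k. b (\<sigma> (2 * k - 1)) (\<sigma> (2 * k)))) k"
      unfolding o_apply by (intro B pf_perms_bounds[OF that])
  qed
  have "(\<Oplus>\<^bsub>qsemigroup r s N\<^esub>\<sigma>\<in>pf_perms n.
        ((- v) ^ inv_count {1..2 * n} \<sigma>) \<odot>\<^bsub>qsemigroup r s N\<^esub> lprod (qsemigroup r s N) (?L \<sigma>)) =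
      (\<Oplus>\<^bsub>qsemigroup r s N\<^esub>\<sigma>\<in>pf_perms n. qclass r s N (?g \<sigma>))"
  proof (rule Q.finsum_cong')
    fix \<sigma> assume \<sigma>: "\<sigma> \<in> pf_perms n"
    have l: "set (?l \<sigma>) \<subseteq> carrier (free_algebra ({1..N} \<times> {1..N}))"
      by (intro pf_list_closed b \<sigma>)
    show "((- v) ^ inv_count {1..2 * n} \<sigma>) \<odot>\<^bsub>qsemigroup r s N\<^esub> lprod (qsemigroup r s N) (?L \<sigma>) =
        qclass r s N (?g \<sigma>)"
      by (simp only: L[OF \<sigma>] qclass_smult[OF free_algebra_prod_list_closed[OF l]]
          qclass_prod_list[OF l])
  qed (auto intro!: qclass_closed closed simp del: upt_Suc One_nat_def)
  also have "\<dots> = qclass r s N (falg.pf_sum v n b)"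
    unfolding falg.pf_sum_def by (intro qclass_sum[symmetric] finite_pf_perms closed)
  finally have eq: "(\<Oplus>\<^bsub>qsemigroup r s N\<^esub>\<sigma>\<in>pf_perms n.
        ((- v) ^ inv_count {1..2 * n} \<sigma>) \<odot>\<^bsub>qsemigroup r s N\<^esub> lprod (qsemigroup r s N) (?L \<sigma>)) =
      qclass r s N (falg.pf_sum v n b)" .
  show ?thesis
  proof -
    have "falg.pf_sum v n b \<in> carrier (free_algebra ({1..N} \<times> {1..N}))"
      by (intro pf_sum_closed b)
    from qclass_smult[OF this] show ?thesis
      unfolding qpf_def by (simp only: eq)
  qed
qed

theorem theorem3p3:
  fixes n :: nat and r s :: complex
    and B B' :: "nat \<Rightarrow> nat \<Rightarrow> (nat \<times> nat) falg set"
  assumes "n \<ge> 1" and "generic r s"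
    and "\<And>i j. 1 \<le> i \<Longrightarrow> i < j \<Longrightarrow> j \<le> 2 * n \<Longrightarrow>
      B i j = (\<Oplus>\<^bsub>qsemigroup r s (2*n)\<^esub>m\<in>{1..n}.
        cdet (qsemigroup r s (2*n)) (inverse s) (qgen r s (2*n)) [2*m - 1, 2*m] [i, j])"
    and "\<And>i j. 1 \<le> i \<Longrightarrow> i < j \<Longrightarrow> j \<le> 2 * n \<Longrightarrow>
      B' i j = (\<Oplus>\<^bsub>qsemigroup r s (2*n)\<^esub>m\<in>{1..n}.
        rdet (qsemigroup r s (2*n)) r (qgen r s (2*n)) [i, j] [2*m - 1, 2*m])"
  shows "qpf (qsemigroup r s (2*n)) r n B = qpf (qsemigroup r s (2*n)) (inverse s) n B'"
proof -
  define N where "N = 2 * n"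
  let ?F = "free_algebra ({1..N} \<times> {1..N})"
  let ?a = "\<lambda>i j. fgen (i, j)"
  \<comment> \<open>These are the entries that \<open>M.pf_transpose\<close> handles: row minors
    with parameter \<open>r\<close> in place of the column minors defining \<open>B\<close>, and
    dually for \<open>?b'\<close>.\<close>
  let ?b = "\<lambda>k l m. ?a (2 * m - 1) k * ?a (2 * m) l - fscal r * (?a (2 * m - 1) l * ?a (2 * m) k)"
  let ?b' = "\<lambda>k l m. ?a k (2 * m - 1) * ?a l (2 * m) -
      fscal (inverse s) * (?a l (2 * m - 1) * ?a k (2 * m))"
  have g: "r \<noteq> 0" "s \<noteq> 0" "\<not> root_of_unity r" "\<not> root_of_unity s" "\<not> root_of_unity (r / s)"
    using assms(2) by (simp_all add: generic_def)
  interpret M: quantum_matrix fscal "qsemigroup_ideal r s N" ?a r s N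
    by (rule qsemigroup_ideal_quantum_matrix[OF g(1,2)])
  interpret Q: ring "qsemigroup r s N" by (rule qsemigroup_ring)
  have m: "2 * m - 1 \<in> {1..N}" "2 * m \<in> {1..N}" "2 * m - 1 < 2 * m" if "m \<in> {1..n}" for m
    using that by (auto simp: N_def)
  have b: "?b k l m \<in> carrier ?F" and b': "?b' k l m \<in> carrier ?F"
    if "k \<in> {1..N}" "l \<in> {1..N}" "m \<in> {1..n}" for k l m
    by (intro minor_closed m that)+
  have B: "B k l = qclass r s N (\<Sum>m\<in>{1..n}. ?b k l m)"
    if "1 \<le> k" "k < l" "l \<le> 2 * n" for k l
  proof -
    have kl: "k \<in> {1..N}" "l \<in> {1..N}" using that by (simp_all add: N_def)
    have "cdet (qsemigroup r s N) (inverse s) (qgen r s N) [2 * m - 1, 2 * m] [k, l] =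
        qclass r s N (?b k l m)" if mn: "m \<in> {1..n}" for m
      unfolding cdet_2[OF m(1,2)[OF mn] kl]
    proof (rule qclass_eqI)
      \<comment> \<open>The leading products cancel, and what remains is the relation
        \<open>anti\<close> for rows \<open>2 * m - 1\<close>, \<open>2 * m\<close> and columns
        \<open>k\<close>, \<open>l\<close>.\<close>
      show "?a (2 * m - 1) k * ?a (2 * m) l - fscal (inverse s) * (?a (2 * m) k * ?a (2 * m - 1) l) -
          ?b k l m \<in> qsemigroup_ideal r s N"
        using M.anti[OF m(1,2)[OF mn] kl m(3)[OF mn] \<open>k < l\<close>] by simp
    qed (intro minor_closed m mn kl)+
    then have "(\<Oplus>\<^bsub>qsemigroup r s N\<^esub>m\<in>{1..n}.
        cdet (qsemigroup r s N) (inverse s) (qgen r s N) [2 * m - 1, 2 * m] [k, l]) =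
        (\<Oplus>\<^bsub>qsemigroup r s N\<^esub>m\<in>{1..n}. qclass r s N (?b k l m))"
      using qclass_closed[OF b[OF kl]] by (intro Q.finsum_cong') (auto simp del: One_nat_def)
    also have "\<dots> = qclass r s N (\<Sum>m\<in>{1..n}. ?b k l m)"
      by (intro qclass_sum[symmetric] finite_atLeastAtMost b kl)
    finally show ?thesis
      using assms(3)[OF that, folded N_def] by simp
  qed
  have B': "B' k l = qclass r s N (\<Sum>m\<in>{1..n}. ?b' k l m)"
    if "1 \<le> k" "k < l" "l \<le> 2 * n" for k l
  proof -
    have kl: "k \<in> {1..N}" "l \<in> {1..N}" using that by (simp_all add: N_def)
    have "rdet (qsemigroup r s N) r (qgen r s N) [k, l] [2 * m - 1, 2 * m] =
        qclass r s N (?b' k l m)" if mn: "m \<in> {1..n}" for m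
      unfolding rdet_2[OF kl m(1,2)[OF mn]]
    proof (rule qclass_eqI)
      \<comment> \<open>Here the difference is the negative of \<open>anti\<close>, with
        \<open>k\<close>, \<open>l\<close> now as rows.\<close>
      show "?a k (2 * m - 1) * ?a l (2 * m) - fscal r * (?a k (2 * m) * ?a l (2 * m - 1)) -
          ?b' k l m \<in> qsemigroup_ideal r s N"
        using M.I_minus[OF M.anti[OF kl m(1,2)[OF mn] \<open>k < l\<close> m(3)[OF mn]]] by simp
    qed (intro minor_closed m mn kl)+
    then have "(\<Oplus>\<^bsub>qsemigroup r s N\<^esub>m\<in>{1..n}.
        rdet (qsemigroup r s N) r (qgen r s N) [k, l] [2 * m - 1, 2 * m]) =
        (\<Oplus>\<^bsub>qsemigroup r s N\<^esub>m\<in>{1..n}. qclass r s N (?b' k l m))"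
      using qclass_closed[OF b'[OF kl]] by (intro Q.finsum_cong') (auto simp del: One_nat_def)
    also have "\<dots> = qclass r s N (\<Sum>m\<in>{1..n}. ?b' k l m)"
      by (intro qclass_sum[symmetric] finite_atLeastAtMost b' kl)
    finally show ?thesis
      using assms(4)[OF that, folded N_def] by simp
  qed
  have closed: "(\<Sum>m\<in>{1..n}. ?b k l m) \<in> carrier ?F" "(\<Sum>m\<in>{1..n}. ?b' k l m) \<in> carrier ?F"
    if "1 \<le> k" "k < l" "l \<le> 2 * n" for k l
  proof -
    have kl: "k \<in> {1..N}" "l \<in> {1..N}" using that by (simp_all add: N_def)
    show "(\<Sum>m\<in>{1..n}. ?b k l m) \<in> carrier ?F"
      by (intro free_algebra_sum_closed b kl)
    show "(\<Sum>m\<in>{1..n}. ?b' k l m) \<in> carrier ?F"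
      by (intro free_algebra_sum_closed b' kl)
  qed
  have "qpf (qsemigroup r s N) r n B =
      qclass r s N (fscal (1 / qfact (r ^ 4) n) * falg.pf_sum r n (\<lambda>k l. \<Sum>m\<in>{1..n}. ?b k l m))"
    by (intro qpf_qclass closed B)
  also have "\<dots> = qclass r s N (fscal (1 / qfact (inverse s ^ 4) n) *
      falg.pf_sum (inverse s) n (\<lambda>k l. \<Sum>m\<in>{1..n}. ?b' k l m))"
    using M.pf_transpose[OF N_def g(3-5)] unfolding M.cong_def
    by (rule qclass_eqI) (rule free_algebra_mult_closed[OF fscal_carrier], intro pf_sum_closed closed;
      assumption)+
  also have "\<dots> = qpf (qsemigroup r s N) (inverse s) n B'"
    by (intro qpf_qclass[symmetric] closed B')
  finally show ?thesis
    by (simp only: N_def)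
qed

end
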